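(* Let $\mathsf{k}$ be a field of characteristic zero and let $X=\{P_1,\dots,P_s\}$ be a set of $s$ distinct ($\mathsf{k}$-rational) points in $\mathbb{P}^2_{\mathsf{k}}$. Let $L_i$ be the linear form dual to $P_i$, and let $A$ be an Artinian Gorenstein quotient of $A(X)$ with dual generator $F=\sum_{i=1}^s\alpha_iL_i^d$, where $d\geq 2\tau(X)$ and $\alpha_i\in\mathsf{k}$, $\alpha_i\neq 0$ for every $i$. Suppose that for some integer $k$ with $1\leq k<\tau(X)$ the first difference of $h_A$ in degrees $0,\dots,\tau(X)$ is $$\Delta h_A=(1,2,h_2-3,\dots,1_k,\dots,1_{\tau(X)}),$$ that is, $\Delta h_A(0)=1$, $\Delta h_A(1)=2$, and $\Delta h_A(i)=1$ for all $k\leq i\leq\tau(X)$. Then there is a linear form $\ell$ such that $\det\mathrm{Hess}^j_\ell(F)\neq 0$ for every $k-1\leq j\leq\lfloor d/2\rfloor$.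
   Context: Let $S=\mathsf{k}[x_0,x_1,x_2]$ (standard grading) act on $R=\mathsf{k}[X_0,X_1,X_2]$ by letting $x_i$ act as $\partial/\partial X_i$; the action is denoted $\circ$. For $F\in R$ homogeneous of degree $d$, $F\ne 0$, the algebra with Macaulay dual generator $F$ is $A=S/\mathrm{Ann}_S(F)$, $\mathrm{Ann}_S(F)=\{g\in S: g\circ F=0\}$; it is Artinian Gorenstein of socle degree $d$. Its Hilbert function is $h_A(i)=h_i=\dim_{\mathsf{k}}A_i$, and $\Delta h_A(0)=h_A(0)$, $\Delta h_A(i)=h_A(i)-h_A(i-1)$ for $i\ge 1$. A subscript on an entry of the vector $\Delta h_A$ records the degree $i$ of that entry. For a finite set $X$ of $s$ distinct points in $\mathbb{P}^2_{\mathsf{k}}$, $I(X)\subset S$ is the homogeneous ideal generated by forms vanishing on $X$, $A(X)=S/I(X)$, $h_{A(X)}(i)=\dim_{\mathsf{k}}A(X)_i$, and $\tau(X)=\min\{i: h_{A(X)}(i)=s\}$. For $P=(a_0:a_1:a_2)$ (with a fixed choice of coordinates) the dual linear form is $L=a_0X_0+a_1X_1+a_2X_2\in R$. If $F=\sum_i\alpha_iL_i^d$ with the $L_i$ dual to the points $P_i\in X$, then $I(X)\subseteq\mathrm{Ann}_S(F)$, so $S/\mathrm{Ann}_S(F)$ is a quotient of $A(X)$. Higher Hessians: choose forms $\alpha^{(j)}_1,\alpha^{(j)}_2,\dots\in S_j$ whose classes form a $\mathsf{k}$-basis of $A_j$. The $j$-th Hessian matrix of $F$ has entries $(\mathrm{Hess}^j(F))_{u,v}=(\alpha^{(j)}_u\alpha^{(j)}_v)\circ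 F\in R$; its determinant is independent of the basis up to a nonzero constant. For a linear form $\ell=a_0x_0+a_1x_1+a_2x_2$, $\mathrm{Hess}^j_\ell(F)$ denotes this matrix evaluated at the point $(X_0,X_1,X_2)=(a_0,a_1,a_2)$. *)

theory Defs
  imports
    "HOL-Library.Poly_Mapping"
    "HOL-Library.Numeral_Type"
    "Jordan_Normal_Form.Determinant"
begin

text \<open>
  Both polynomial rings \<open>S = k[x\<^sub>0,x\<^sub>1,x\<^sub>2]\<close> and \<open>R = k[X\<^sub>0,X\<^sub>1,X\<^sub>2]\<close> are modelled by finitely supported
  functions from exponent vectors to coefficients; the product of \<^typ>\<open>'a \<Rightarrow>\<^sub>0 'b\<close> is
  the convolution product. The variables are indexed by the three-element type \<^typ>\<open>3\<close>, whose
  elements are \<open>0\<close>, \<open>1\<close>, \<open>2\<close> (arithmetic in it is modulo three, so \<open>3 = 0\<close>).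
\<close>

type_synonym 'k pol = "(3 \<Rightarrow>\<^sub>0 nat) \<Rightarrow>\<^sub>0 'k"

definition cst :: "'k::zero \<Rightarrow> 'k pol" where
  "cst c = Poly_Mapping.single 0 c"

definition mdeg :: "(3 \<Rightarrow>\<^sub>0 nat) \<Rightarrow> nat" where
  "mdeg m = (\<Sum>i\<in>UNIV. Poly_Mapping.lookup m i)"

text \<open>The graded piece of degree \<open>j\<close>; it contains \<open>0\<close>.\<close>

definition forms :: "nat \<Rightarrow> 'k::zero pol set" where
  "forms j = {f. \<forall>m\<in>Poly_Mapping.keys f. mdeg m = j}"

definition eval_pol :: "'k::comm_semiring_1 pol \<Rightarrow> (3 \<Rightarrow> 'k) \<Rightarrow> 'k" where
  "eval_pol f a = (\<Sum>m\<in>Poly_Mapping.keys f.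
     Poly_Mapping.lookup f m * (\<Prod>i\<in>UNIV. a i ^ Poly_Mapping.lookup m i))"

definition linear_form :: "(3 \<Rightarrow> 'k::comm_monoid_add) \<Rightarrow> 'k pol" where
  "linear_form a = (\<Sum>i\<in>UNIV. Poly_Mapping.single (Poly_Mapping.single i 1) (a i))"

text \<open>Truncated subtraction of exponents is harmless here: when \<open>X\<^sub>i\<close> does not occur in the
  monomial, the coefficient is \<open>0\<close>.\<close>

definition partial :: "3 \<Rightarrow> 'k::comm_semiring_1 pol \<Rightarrow> 'k pol" where
  "partial i F = (\<Sum>m\<in>Poly_Mapping.keys F.
     Poly_Mapping.single (m - Poly_Mapping.single i 1)
       (of_nat (Poly_Mapping.lookup m i) * Poly_Mapping.lookup F m))"

definition mono_act :: "(3 \<Rightarrow>\<^sub>0 nat) \<Rightarrow> 'k::comm_semiring_1 pol \<Rightarrow> 'k pol" where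
  "mono_act m F =
     (partial 0 ^^ Poly_Mapping.lookup m 0)
       ((partial 1 ^^ Poly_Mapping.lookup m 1)
         ((partial 2 ^^ Poly_Mapping.lookup m 2) F))"

text \<open>The action \<open>g \<circ> F\<close> of \<open>S\<close> on \<open>R\<close> in which \<open>x\<^sub>i\<close> acts as \<open>\<partial>/\<partial>X\<^sub>i\<close>.\<close>

definition act :: "'k::comm_semiring_1 pol \<Rightarrow> 'k pol \<Rightarrow> 'k pol" where
  "act g F = (\<Sum>m\<in>Poly_Mapping.keys g. cst (Poly_Mapping.lookup g m) * mono_act m F)"

definition Ann :: "'k::comm_semiring_1 pol \<Rightarrow> 'k pol set" where
  "Ann F = {g. act g F = 0}"

text \<open>For a homogeneous ideal \<open>I\<close>: the classes of the forms \<open>bs\<close> are a \<open>k\<close>-basis of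
  \<open>(S/I)\<^sub>j\<close>, the image of \<open>S\<^sub>j\<close> in \<open>S/I\<close>. The two quantified conjuncts are linear independence
  and spanning in the quotient.\<close>

definition quot_basis :: "'k::field pol set \<Rightarrow> nat \<Rightarrow> 'k pol list \<Rightarrow> bool" where
  "quot_basis I j bs \<longleftrightarrow> set bs \<subseteq> forms j \<and>
     (\<forall>c. (\<Sum>u<length bs. cst (c u) * bs ! u) \<in> I \<longrightarrow> (\<forall>u<length bs. c u = 0)) \<and>
     (\<forall>f\<in>forms j. \<exists>c. f - (\<Sum>u<length bs. cst (c u) * bs ! u) \<in> I)"

text \<open>The Hilbert function of \<open>S/I\<close>, i.e. \<open>dim (S/I)\<^sub>j\<close> as the common length of all bases.\<close>

definition hilbert_fun :: "'k::field pol set \<Rightarrow> nat \<Rightarrow> nat" where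
  "hilbert_fun I j = (THE n. \<exists>bs. quot_basis I j bs \<and> length bs = n)"

definition delta_hilbert :: "'k::field pol set \<Rightarrow> nat \<Rightarrow> int" where
  "delta_hilbert I i =
     (if i = 0 then int (hilbert_fun I 0)
      else int (hilbert_fun I i) - int (hilbert_fun I (i - 1)))"

text \<open>Points of \<open>\<bbbP>\<^sup>2\<close> are given by fixed homogeneous coordinates; \<open>P\<^sub>0,\<dots>,P\<^bsub>s-1\<^esub>\<close> are
  distinct points when these vectors are nonzero and pairwise non-proportional.\<close>

definition same_point :: "(3 \<Rightarrow> 'k::field) \<Rightarrow> (3 \<Rightarrow> 'k) \<Rightarrow> bool" where
  "same_point p q \<longleftrightarrow> (\<exists>c. c \<noteq> 0 \<and> (\<forall>i. q i = c * p i))"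

definition distinct_points :: "nat \<Rightarrow> (nat \<Rightarrow> 3 \<Rightarrow> 'k::field) \<Rightarrow> bool" where
  "distinct_points s P \<longleftrightarrow>
     (\<forall>i<s. P i \<noteq> (\<lambda>_. 0)) \<and> (\<forall>i<s. \<forall>j<s. i \<noteq> j \<longrightarrow> \<not> same_point (P i) (P j))"

text \<open>The ideal generated by the forms vanishing on \<open>X\<close>: ideals of a commutative ring are its
  submodules, so the span is taken over the ring itself.\<close>

definition vanishing_ideal :: "(3 \<Rightarrow> 'k::field) set \<Rightarrow> 'k pol set" where
  "vanishing_ideal X =
     module.span (*) {f. (\<exists>j. f \<in> forms j) \<and> (\<forall>p\<in>X. eval_pol f p = 0)}"

text \<open>\<open>\<tau>(X)\<close>, for a set \<open>X\<close> of pairwise non-proportional coordinate vectors, so that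
  \<open>card X\<close> is the number of points.\<close>

definition tau :: "(3 \<Rightarrow> 'k::field) set \<Rightarrow> nat" where
  "tau X = (LEAST i. hilbert_fun (vanishing_ideal X) i = card X)"

definition hess :: "'k::field pol \<Rightarrow> 'k pol list \<Rightarrow> 'k pol mat" where
  "hess F bs = mat (length bs) (length bs) (\<lambda>(u, v). act (bs ! u * bs ! v) F)"

text \<open>The Hessian matrix evaluated at the point whose coordinates are the coefficients of the
  linear form \<open>l\<close>.\<close>

definition hess_at :: "'k::field pol \<Rightarrow> 'k pol \<Rightarrow> 'k pol list \<Rightarrow> 'k mat" where
  "hess_at l F bs =
     map_mat (\<lambda>G. eval_pol G (\<lambda>i. Poly_Mapping.lookup l (Poly_Mapping.single i 1))) (hess F bs)"

end

theory Submission
  imports Defs "HOL-Computational_Algebra.Polynomial"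
begin

text \<open>
  By apolarity, \<open>Hess\<^sup>j\<close> at \<open>a\<close> is, up to a nonzero factor, the Gram matrix of the form
  \<open>(f, g) \<mapsto> \<Sum> \<alpha>\<^sub>p L\<^sub>p(a)\<^bsup>d-2j\<^esup> f(p) g(p)\<close>, and \<open>Ann F\<close> agrees with \<open>I(X)\<close> in degrees up to \<open>d - \<tau>\<close>.
  An \<open>f\<close> in its kernel gives a linear relation \<open>\<nu>\<^sub>p = \<alpha>\<^sub>p L\<^sub>p(a)\<^bsup>d-2j\<^esup> f(p)\<close> among the evaluations of forms
  of degree \<open>j\<close> at the points; there is none for \<open>j \<ge> \<tau>\<close>.
  For \<open>k - 1 \<le> j \<le> \<tau>\<close> the relations have dimension \<open>\<tau> - j\<close>. Let \<open>\<mu>\<close> be the one in degree \<open>\<tau> - 1\<close>. Its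
  three multiples by the coordinates live in a space of dimension two, so \<open>\<mu>\<close> is supported on a line,
  on at least \<open>\<tau> + 1\<close> points, and all relations in degree \<open>j\<close> are multiples of \<open>\<mu>\<close> by binary forms of
  degree \<open>\<tau> - 1 - j\<close>. Hence \<open>f\<close> vanishes off the line. On the line, \<open>L(a)\<^bsup>d-2j\<^esup> f\<close> lies in a space of
  binary forms, independent of \<open>a\<close>, of dimension at most \<open>d - 2j\<close>; in characteristic zero, for general
  \<open>a\<close> no nonzero element of such a space is divisible by \<open>L(a)\<^bsup>d-2j\<^esup>\<close>.
\<close>

subsection \<open>Linear systems and univariate polynomials\<close>

text \<open>Gaussian elimination, by induction on the equations: an unknown occurring in equation
  \<open>q\<close> is eliminated from the others, which removes one equation and one
  unknown.\<close>

lemma homogeneous_system_nontrivial: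
  fixes A :: "'t \<Rightarrow> 'q \<Rightarrow> 'k::field"
  assumes "finite Q" "finite T" "card Q < card T"
  shows "\<exists>c. (\<exists>t\<in>T. c t \<noteq> 0) \<and> (\<forall>q\<in>Q. (\<Sum>t\<in>T. c t * A t q) = 0)"
  using assms
proof (induction Q arbitrary: T A rule: finite_induct)
  case empty
  then obtain t where "t \<in> T" by fastforce
  then show ?case by (intro exI[of _ "\<lambda>_. 1"]) auto
next
  case (insert q Q)
  show ?case
  proof (cases "\<forall>t\<in>T. A t q = 0")
    case True
    obtain c where "\<exists>t\<in>T. c t \<noteq> 0" "\<forall>q\<in>Q. (\<Sum>t\<in>T. c t * A t q) = 0"
      using insert.IH[of T A] insert.prems insert.hyps by fastforce
    with True show ?thesis by (intro exI[of _ c]) auto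
  next
    case False
    then obtain t0 where t0: "t0 \<in> T" "A t0 q \<noteq> 0" by blast
    define B where "B t x = A t x - A t q / A t0 q * A t0 x" for t x
    have "card Q < card (T - {t0})"
      using insert.prems insert.hyps t0 by simp
    then obtain c where c: "\<exists>t\<in>T - {t0}. c t \<noteq> 0" "\<forall>x\<in>Q. (\<Sum>t\<in>T - {t0}. c t * B t x) = 0"
      using insert.IH[of "T - {t0}" B] insert.prems by auto
    \<comment> \<open>The value that equation \<open>q\<close> forces on the pivot unknown
      \<open>t0\<close>.\<close>
    define r where "r = - (\<Sum>t\<in>T - {t0}. c t * A t q) / A t0 q"
    have sum: "(\<Sum>t\<in>T. (c(t0 := r)) t * A t x) = (\<Sum>t\<in>T - {t0}. c t * B t x)" for x
    proof -
      have "(\<Sum>t\<in>T. (c(t0 := r)) t * A t x)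
          = r * A t0 x + (\<Sum>t\<in>T - {t0}. c t * A t x)"
        using t0 insert.prems by (simp add: sum.remove)
      also have "\<dots> = (\<Sum>t\<in>T - {t0}. c t * B t x)"
        by (simp add: B_def r_def right_diff_distrib sum_subtractf sum_divide_distrib
            sum_distrib_right sum_negf mult.assoc)
      finally show ?thesis .
    qed
    have "(\<Sum>t\<in>T - {t0}. c t * B t q) = 0"
      using t0 by (simp add: B_def)
    then show ?thesis
      using c sum by (intro exI[of _ "c(t0 := r)"]) auto
  qed
qed

text \<open>Every genericity condition below is phrased as avoidance of a finite set of
  scalars.\<close>

lemma finite_avoid:
  assumes "finite (E :: 'k::field_char_0 set)"
  obtains c where "c \<notin> E"
  using ex_new_if_finite[OF infinite_UNIV_char_0 assms] by blast

text \<open>Subtracting the multiple of \<open>g\<close> that kills the coefficient in degree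
  \<open>degree g\<close> leaves \<open>h\<close>. If \<open>h\<close> is nonzero, its degree
  differs from that of \<open>g\<close>; comparing the coefficients of \<open>g * pderiv h\<close>
  and \<open>pderiv g * h\<close> in degree \<open>degree g + degree h - 1\<close> then makes the
  two degrees equal in characteristic zero.\<close>

lemma wronskian_zero_imp_proportional:
  fixes f g :: "'k::field_char_0 poly"
  assumes g: "g \<noteq> 0" and W: "g * pderiv f = pderiv g * f"
  shows "\<exists>c. f = smult c g"
proof -
  define c where "c = coeff f (degree g) / lead_coeff g"
  define h where "h = f - smult c g"
  have Wh: "g * pderiv h = pderiv g * h"
    using W by (simp add: h_def pderiv_diff pderiv_smult algebra_simps)
  have hg: "coeff h (degree g) = 0"
    using g by (simp add: h_def c_def)
  have "h = 0"
  proof (rule ccontr)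
    assume h: "h \<noteq> 0"
    have ne: "degree h \<noteq> degree g" using hg h by (metis leading_coeff_0_iff)
    let ?n = "degree g + degree h"
    have *: "coeff (p * pderiv q) (degree p + degree q - 1) = of_nat (degree q) * lead_coeff p * lead_coeff q"
      if "degree q > 0" for p q :: "'k poly"
    proof -
      have "degree (pderiv q) = degree q - 1" by (rule degree_pderiv)
      then have "degree p + degree q - 1 = degree p + degree (pderiv q)" using that by simp
      then have "coeff (p * pderiv q) (degree p + degree q - 1) = lead_coeff p * lead_coeff (pderiv q)"
        by (simp only: coeff_mult_degree_sum)
      also have "lead_coeff (pderiv q) = of_nat (degree q) * lead_coeff q"
        using that by (simp add: degree_pderiv coeff_pderiv)
      finally show ?thesis by simp
    qed
    have **: "coeff (p * pderiv q) (degree p + degree q - 1) = of_nat (degree q) * lead_coeff p * lead_coeff q"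
      for p q :: "'k poly"
    proof (cases "degree q > 0")
      case False
      then have "pderiv q = 0" by (simp add: pderiv_eq_0_iff)
      then show ?thesis using False by simp
    qed (rule *)
    have "of_nat (degree h) * lead_coeff g * lead_coeff h = of_nat (degree g) * lead_coeff h * lead_coeff g"
      using Wh **[of g h] **[of h g] by (metis add.commute mult.commute)
    then have "(of_nat (degree h) :: 'k) = of_nat (degree g)" using g h by simp
    then show False using ne by simp
  qed
  then show ?thesis by (auto simp: h_def)
qed

text \<open>Induction on the dimension replaces the Wronskian: if \<open>g\<close> is one of the spanning
  polynomials, then \<open>f \<mapsto> g f' - g' f\<close> has kernel spanned by \<open>g\<close> and lowers the order of
  vanishing by at most one.\<close>

lemma finite_points_of_high_order_vanishing:
  fixes p :: "'t \<Rightarrow> 'k::field_char_0 poly"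
  assumes "finite T"
  shows "\<exists>E. finite E \<and> (\<forall>c. c \<notin> E \<longrightarrow>
    (\<forall>a. [:- c, 1:] ^ card T dvd (\<Sum>t\<in>T. smult (a t) (p t)) \<longrightarrow> (\<Sum>t\<in>T. smult (a t) (p t)) = 0))"
  using assms
proof (induction T arbitrary: p rule: finite_induct)
  case empty
  then show ?case by auto
next
  case (insert t0 T)
  show ?case
  proof (cases "p t0 = 0")
    case True
    obtain E where E: "finite E" "\<And>c a. c \<notin> E \<Longrightarrow>
        [:- c, 1:] ^ card T dvd (\<Sum>t\<in>T. smult (a t) (p t)) \<Longrightarrow> (\<Sum>t\<in>T. smult (a t) (p t)) = 0"
      using insert.IH[of p] by metis
    have "[:- c, 1:] ^ card T dvd f" if "[:- c, 1:] ^ card (insert t0 T) dvd f" for c f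
      using that insert.hyps by (intro power_le_dvd[OF that]) simp
    moreover have "(\<Sum>t\<in>insert t0 T. smult (a t) (p t)) = (\<Sum>t\<in>T. smult (a t) (p t))" for a
      using insert.hyps True by simp
    ultimately show ?thesis using E by metis
  next
    case False
    define g where "g = p t0"
    define D where "D f = g * pderiv f - pderiv g * f" for f
    obtain E where E: "finite E" "\<And>c a. c \<notin> E \<Longrightarrow>
        [:- c, 1:] ^ card T dvd (\<Sum>t\<in>T. smult (a t) (D (p t))) \<Longrightarrow>
        (\<Sum>t\<in>T. smult (a t) (D (p t))) = 0"
      using insert.IH[of "\<lambda>t. D (p t)"] by metis
    have g: "g \<noteq> 0" using False by (simp add: g_def)
    \<comment> \<open>Roots of \<open>g\<close> are excluded too: once \<open>D f = 0\<close> makes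
      \<open>f\<close> a scalar multiple of \<open>g\<close>, the zero of \<open>f\<close> at
      \<open>c\<close> forces \<open>f = 0\<close>.\<close>
    have "(\<Sum>t\<in>insert t0 T. smult (a t) (p t)) = 0"
      if c: "c \<notin> E \<union> {x. poly g x = 0}"
        and dvd: "[:- c, 1:] ^ card (insert t0 T) dvd (\<Sum>t\<in>insert t0 T. smult (a t) (p t))" for c a
    proof -
      define f where "f = (\<Sum>t\<in>insert t0 T. smult (a t) (p t))"
      have f: "f = smult (a t0) g + (\<Sum>t\<in>T. smult (a t) (p t))"
        using insert.hyps by (simp add: f_def g_def)
      have Dadd: "D (x + y) = D x + D y" for x y
        by (simp add: D_def pderiv_add algebra_simps)
      have Dsm: "D (smult r x) = smult r (D x)" for r x
        by (simp add: D_def pderiv_smult smult_diff_right)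
      have D0: "D 0 = 0" by (simp add: D_def)
      have Dsum: "D (\<Sum>t\<in>T. smult (a t) (p t)) = (\<Sum>t\<in>T. smult (a t) (D (p t)))"
        using insert.hyps(1) by (induction T rule: finite_induct) (auto simp: Dadd Dsm D0)
      have Dg: "D g = 0" by (simp add: D_def)
      have Df: "D f = (\<Sum>t\<in>T. smult (a t) (D (p t)))"
        by (simp add: f Dadd Dsm Dsum Dg)
      have dvd': "[:- c, 1:] ^ Suc (card T) dvd f"
        using dvd insert.hyps by (simp add: f_def)
      then obtain h where h: "f = [:- c, 1:] ^ Suc (card T) * h" by (rule dvdE)
      have "pderiv (u ^ Suc n * v) = u ^ n * (u * pderiv v + smult (of_nat (Suc n)) (pderiv u) * v)"
        for u v :: "'k poly" and n
        by (simp only: pderiv_mult pderiv_power_Suc) (simp add: algebra_simps del: of_nat_Suc)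
      then have "[:- c, 1:] ^ card T dvd pderiv f"
        unfolding h by (metis dvd_triv_left)
      moreover have "[:- c, 1:] ^ card T dvd f"
        by (rule power_le_dvd[OF dvd']) simp
      ultimately have "[:- c, 1:] ^ card T dvd D f"
        by (simp add: D_def dvd_diff)
      then have "D f = 0" using E(2)[of c a] c Df by simp
      then obtain r where r: "f = smult r g"
        using wronskian_zero_imp_proportional[OF g, of f] by (auto simp: D_def)
      have "poly f c = 0" by (simp add: h)
      then have "f = 0" using r c by auto
      then show ?thesis by (simp add: f_def)
    qed
    then show ?thesis
      using E(1) poly_roots_finite[OF g] by (intro exI[of _ "E \<union> {x. poly g x = 0}"]) blast
  qed
qed

text \<open>Lagrange's formula; an empty \<open>Z\<close> is excluded because no degree is below
  0.\<close>

lemma lagrange_interpolation: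
  fixes t :: "'i \<Rightarrow> 'k::field"
  assumes "finite Z" "Z \<noteq> {}" "inj_on t Z"
  shows "\<exists>q. degree q < card Z \<and> (\<forall>i\<in>Z. poly q (t i) = y i)"
proof -
  define q where "q = (\<Sum>i\<in>Z. smult (y i / (\<Prod>l\<in>Z - {i}. t i - t l)) (\<Prod>l\<in>Z - {i}. [:- t l, 1:]))"
  have "poly q (t i) = y i" if i: "i \<in> Z" for i
  proof -
    have ne: "(\<Prod>l\<in>Z - {i}. t i - t l) \<noteq> 0"
      using assms(1,3) i by (auto simp: inj_on_def)
    have "poly q (t i) = (\<Sum>m\<in>Z. if m = i then y i else 0)"
      unfolding q_def poly_sum
    proof (rule sum.cong[OF refl])
      fix m assume m: "m \<in> Z"
      show "poly (smult (y m / (\<Prod>l\<in>Z - {m}. t m - t l)) (\<Prod>l\<in>Z - {m}. [:- t l, 1:])) (t i) =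
        (if m = i then y i else 0)"
      proof (cases "m = i")
        case True
        then show ?thesis using ne by (simp add: poly_prod)
      next
        case False
        then have "(\<Prod>l\<in>Z - {m}. t i - t l) = 0"
          using assms(1) i by auto
        then show ?thesis using False by (simp add: poly_prod)
      qed
    qed
    then show ?thesis using assms(1) i by simp
  qed
  moreover have "degree q \<le> card Z - 1"
    unfolding q_def
  proof (rule degree_sum_le)
    fix i assume i: "i \<in> Z"
    have "degree (\<Prod>l\<in>Z - {i}. [:- t l, 1:]) = card Z - 1"
      using assms(1) i by (simp add: degree_prod_eq_sum_degree)
    then show "degree (smult (y i / (\<Prod>l\<in>Z - {i}. t i - t l)) (\<Prod>l\<in>Z - {i}. [:- t l, 1:])) \<le> card Z - 1"
      using degree_smult_le by metis
  qed (rule assms)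
  moreover have "card Z > 0" using assms by (simp add: card_gt_0_iff)
  ultimately show ?thesis by (intro exI[of _ q]) auto
qed

lemma prod_linear_factors_dvd:
  fixes D :: "'k::field poly"
  assumes "finite S" "\<And>a. a \<in> S \<Longrightarrow> poly D a = 0"
  shows "(\<Prod>a\<in>S. [:- a, 1:]) dvd D"
  using assms
proof (induction S rule: finite_induct)
  case (insert a S)
  then have "(\<Prod>a\<in>S. [:- a, 1:]) dvd D" by simp
  then obtain r where r: "D = (\<Prod>a\<in>S. [:- a, 1:]) * r" by (rule dvdE)
  have "poly (\<Prod>a\<in>S. [:- a, 1:]) a \<noteq> 0"
    using insert.hyps by (auto simp: poly_prod)
  then have "poly r a = 0" using insert.prems[of a] r by auto
  then have "[:- a, 1:] dvd r" by (simp add: poly_eq_0_iff_dvd)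
  then show ?case using insert.hyps by (simp add: r mult.commute mult_dvd_mono del: mult_pCons_left mult_pCons_right)
qed simp

text \<open>The case \<open>r = 0\<close> is listed separately because the zero polynomial has
  degree 0 and must be allowed when \<open>n = 0\<close>.\<close>

lemma poly_as_sum_lessThan:
  fixes r :: "'k::comm_semiring_1 poly"
  assumes "r = 0 \<or> degree r < n"
  shows "(\<Sum>i<n. smult (coeff r i) (monom 1 i)) = r"
proof (rule poly_eqI)
  fix l
  have "coeff (\<Sum>i<n. smult (coeff r i) (monom 1 i)) l = (\<Sum>i<n. if i = l then coeff r i else 0)"
    unfolding coeff_sum by (rule sum.cong) auto
  also have "\<dots> = coeff r l"
    using assms by (auto simp: coeff_eq_0)
  finally show "coeff (\<Sum>i<n. smult (coeff r i) (monom 1 i)) l = coeff r l" .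
qed

text \<open>The polynomials \<open>(x - c)\<^sup>e q\<close> in question lie in the span of the interpolants of
  \<open>\<gamma> t\<^sup>i\<close> for \<open>i < n\<close> and of the multiples of \<open>\<Prod>(x - t p)\<close>, a space of dimension at most \<open>e\<close>.\<close>

lemma generic_interpolation_trivial:
  fixes t :: "'i \<Rightarrow> 'k::field_char_0"
  assumes Z: "finite Z" "Z \<noteq> {}" "inj_on t Z" and dim: "n + (e + j + 1 - card Z) \<le> e"
  shows "\<exists>E. finite E \<and> (\<forall>c. c \<notin> E \<longrightarrow> (\<forall>q b. degree q \<le> j \<longrightarrow> (b = 0 \<or> degree b < n) \<longrightarrow>
    (\<forall>p\<in>Z. (t p - c) ^ e * poly q (t p) = \<gamma> p * poly b (t p)) \<longrightarrow> q = 0))"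
proof -
  \<comment> \<open>The number of coefficients of a cofactor of \<open>\<Omega>\<close> in degree at
    most \<open>e + j\<close>; truncation gives 0 when \<open>card Z\<close> exceeds
    \<open>e + j\<close>.\<close>
  define r where "r = e + j + 1 - card Z"
  define \<Omega> where "\<Omega> = (\<Prod>a\<in>t ` Z. [:- a, 1:])"
  have deg\<Omega>: "degree \<Omega> = card Z"
    using Z by (simp add: \<Omega>_def degree_prod_eq_sum_degree card_image)
  have \<Omega>0: "\<Omega> \<noteq> 0" using Z by (simp add: \<Omega>_def)
  have "\<forall>i\<in>{..<n}. \<exists>q. degree q < card Z \<and> (\<forall>p\<in>Z. poly q (t p) = \<gamma> p * t p ^ i)"
    using lagrange_interpolation[OF Z, of "\<lambda>p. \<gamma> p * t p ^ _"] by blast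
  from bchoice[OF this] obtain Q where Q: "\<And>i. i < n \<Longrightarrow> degree (Q i) < card Z"
      "\<And>i p. i < n \<Longrightarrow> p \<in> Z \<Longrightarrow> poly (Q i) (t p) = \<gamma> p * t p ^ i"
    by auto
  \<comment> \<open>The spanning list: first the \<open>n\<close> interpolants, then
    \<open>r\<close> products of \<open>\<Omega>\<close> with monomials.\<close>
  define P where "P i = (if i < n then Q i else \<Omega> * monom 1 (i - n))" for i
  obtain E where E: "finite E" "\<And>c a. c \<notin> E \<Longrightarrow>
      [:- c, 1:] ^ (n + r) dvd (\<Sum>i<n + r. smult (a i) (P i)) \<Longrightarrow> (\<Sum>i<n + r. smult (a i) (P i)) = 0"
    using finite_points_of_high_order_vanishing[of "{..<n + r}" P] by auto
  have "q = 0" if c: "c \<notin> E" and q: "degree q \<le> j" and b: "b = 0 \<or> degree b < n"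
    and eq: "\<forall>p\<in>Z. (t p - c) ^ e * poly q (t p) = \<gamma> p * poly b (t p)" for c q b
  proof -
    define f where "f = [:- c, 1:] ^ e * q"
    define D where "D = f - (\<Sum>i<n. smult (coeff b i) (Q i))"
    have bt: "poly b x = (\<Sum>i<n. coeff b i * x ^ i)" for x
      by (subst poly_as_sum_lessThan[OF b, symmetric]) (simp add: poly_sum poly_monom)
    have "poly D (t p) = 0" if "p \<in> Z" for p
    proof -
      have "poly f (t p) = \<gamma> p * poly b (t p)" using eq that by (simp add: f_def)
      also have "\<dots> = (\<Sum>i<n. coeff b i * poly (Q i) (t p))"
        using Q(2)[OF _ that] by (simp add: bt sum_distrib_left mult_ac)
      finally show ?thesis by (simp add: D_def poly_sum)
    qed
    then have "\<Omega> dvd D" unfolding \<Omega>_def using Z by (intro prod_linear_factors_dvd) auto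
    then obtain h where h: "D = \<Omega> * h" by (rule dvdE)
    \<comment> \<open>A longer cofactor would give \<open>D\<close> a degree above both
      \<open>e + j\<close> and \<open>card Z - 1\<close>.\<close>
    have "h = 0 \<or> degree h < r"
    proof (rule ccontr)
      assume neg: "\<not> ?thesis"
      then have degD: "degree D = card Z + degree h" by (simp add: h degree_mult_eq \<Omega>0 deg\<Omega>)
      have "degree f \<le> e + j"
      proof -
        have "degree f \<le> degree ([:- c, 1:] ^ e) + degree q" unfolding f_def by (rule degree_mult_le)
        then show ?thesis using q by (simp add: degree_linear_power)
      qed
      moreover have "degree (\<Sum>i<n. smult (coeff b i) (Q i)) \<le> card Z - 1"
      proof (rule degree_sum_le)
        fix i assume "i \<in> {..<n}"
        then show "degree (smult (coeff b i) (Q i)) \<le> card Z - 1"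
          using Q(1)[of i] degree_smult_le[of "coeff b i" "Q i"] by simp
      qed simp
      ultimately have "degree D \<le> max (e + j) (card Z - 1)"
        unfolding D_def by (intro degree_diff_le_max[THEN order_trans]) auto
      then show False using degD neg Z by (auto simp: r_def max_def card_gt_0_iff split: if_splits)
    qed
    then have hs: "(\<Sum>i<r. smult (coeff h i) (monom 1 i)) = h" by (rule poly_as_sum_lessThan)
    define a where "a i = (if i < n then coeff b i else coeff h (i - n))" for i
    have "(\<Sum>i<n + r. smult (a i) (P i)) = (\<Sum>i<n. smult (a i) (P i)) + (\<Sum>i<r. smult (a (n + i)) (P (n + i)))"
      by (induction r) (simp_all add: add.assoc)
    also have "(\<Sum>i<n. smult (a i) (P i)) = (\<Sum>i<n. smult (coeff b i) (Q i))"
      by (simp add: a_def P_def)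
    also have "(\<Sum>i<r. smult (a (n + i)) (P (n + i))) = \<Omega> * (\<Sum>i<r. smult (coeff h i) (monom 1 i))"
      by (simp add: a_def P_def sum_distrib_left)
    finally have f: "(\<Sum>i<n + r. smult (a i) (P i)) = f"
      by (simp add: hs h[symmetric] D_def)
    have "[:- c, 1:] ^ e dvd f" unfolding f_def by simp
    \<comment> \<open>By \<open>dim\<close>, the number \<open>n + r\<close> of generators is at
      most the order \<open>e\<close> of the zero at \<open>c\<close>.\<close>
    then have "[:- c, 1:] ^ (n + r) dvd f"
      by (rule power_le_dvd) (use dim in \<open>simp add: r_def\<close>)
    then have "f = 0" using E(2)[OF c, of a] f by simp
    then show "q = 0" by (simp add: f_def)
  qed
  then show ?thesis using E(1) by blast
qed

subsection \<open>Evaluation and the apolarity action\<close>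

lemma poly_mapping_sum_monomials:
  "f = (\<Sum>m\<in>Poly_Mapping.keys f. Poly_Mapping.single m (Poly_Mapping.lookup f m))"
proof (rule poly_mapping_eqI)
  fix k
  have "Poly_Mapping.lookup (\<Sum>m\<in>Poly_Mapping.keys f. Poly_Mapping.single m (Poly_Mapping.lookup f m)) k
      = (\<Sum>m\<in>Poly_Mapping.keys f. if m = k then Poly_Mapping.lookup f m else 0)"
    by (simp add: lookup_sum lookup_single when_def)
  also have "\<dots> = Poly_Mapping.lookup f k"
    by (simp add: in_keys_iff)
  finally show "Poly_Mapping.lookup f k = Poly_Mapping.lookup (\<Sum>m\<in>Poly_Mapping.keys f. Poly_Mapping.single m (Poly_Mapping.lookup f m)) k" ..
qed

lemma pol_induct [case_names zero monomial add]:
  assumes "Q 0" "\<And>m c. Q (Poly_Mapping.single m c)" "\<And>f g. Q f \<Longrightarrow> Q g \<Longrightarrow> Q (f + g)"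
  shows "Q (f :: 'b \<Rightarrow>\<^sub>0 'k::comm_monoid_add)"
proof -
  have "Q (\<Sum>m\<in>S. Poly_Mapping.single m (Poly_Mapping.lookup f m))" if "finite S" for S
    using that by (induction S rule: finite_induct) (auto intro: assms)
  from this[of "Poly_Mapping.keys f"] show ?thesis
    using poly_mapping_sum_monomials[of f] by simp
qed

text \<open>Cancellation can make the support of \<open>f + g\<close> smaller than the union of the
  supports, so all three sums are extended to the union, where \<open>h m 0 = 0\<close> kills the
  added terms.\<close>

lemma sum_keys_add:
  assumes "\<And>m. h m 0 = 0" "\<And>m c d. h m (c + d) = h m c + h m d"
  shows "(\<Sum>m\<in>Poly_Mapping.keys (f + g). h m (Poly_Mapping.lookup (f + g) m))
    = (\<Sum>m\<in>Poly_Mapping.keys f. h m (Poly_Mapping.lookup f m))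
      + (\<Sum>m\<in>Poly_Mapping.keys g. h m (Poly_Mapping.lookup g m))"
proof -
  let ?K = "Poly_Mapping.keys f \<union> Poly_Mapping.keys g"
  have ext: "(\<Sum>m\<in>Poly_Mapping.keys e. h m (Poly_Mapping.lookup e m))
      = (\<Sum>m\<in>?K. h m (Poly_Mapping.lookup e m))" if "Poly_Mapping.keys e \<subseteq> ?K" for e
    using that assms(1) by (intro sum.mono_neutral_left) (auto simp: in_keys_iff)
  show ?thesis
    using ext[of "f + g"] ext[of f] ext[of g] Poly_Mapping.keys_add[of f g]
    by (simp add: lookup_add assms(2) sum.distrib)
qed

lemma eval_pol_0 [simp]: "eval_pol 0 a = 0"
  by (simp add: eval_pol_def)

lemma eval_pol_single:
  "eval_pol (Poly_Mapping.single m c) a = c * (\<Prod>i\<in>UNIV. a i ^ Poly_Mapping.lookup m i)"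
  by (cases "c = 0") (simp_all add: eval_pol_def)

lemma eval_pol_add [simp]: "eval_pol (f + g) a = eval_pol f a + eval_pol g a"
  unfolding eval_pol_def by (rule sum_keys_add) (auto simp: algebra_simps)

lemma eval_pol_mult [simp]: "eval_pol (f * g) a = eval_pol f a * eval_pol g a"
proof (induction f rule: pol_induct)
  case (monomial m c)
  show ?case
  proof (induction g rule: pol_induct)
    case (monomial m' c')
    show ?case
      by (simp add: mult_single eval_pol_single lookup_add power_add prod.distrib mult_ac)
  qed (simp_all add: distrib_left)
qed (simp_all add: distrib_right)

lemma eval_pol_cst [simp]: "eval_pol (cst c) a = c"
  by (simp add: cst_def eval_pol_single)

lemma eval_pol_1 [simp]: "eval_pol 1 a = 1"
  by (metis eval_pol_cst cst_def single_one)

lemma eval_pol_sum [simp]: "eval_pol (\<Sum>i\<in>I. f i) a = (\<Sum>i\<in>I. eval_pol (f i) a)"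
  by (induction I rule: infinite_finite_induct) auto

lemma eval_pol_prod [simp]: "eval_pol (\<Prod>i\<in>I. f i) a = (\<Prod>i\<in>I. eval_pol (f i) a)"
  by (induction I rule: infinite_finite_induct) auto

lemma eval_pol_power [simp]: "eval_pol (f ^ n) a = eval_pol f a ^ n"
  by (induction n) auto

lemma eval_pol_diff [simp]: "eval_pol (f - g) a = eval_pol f a - (eval_pol g a :: 'k::comm_ring_1)"
  using eval_pol_add[of "f - g" g a] by simp

lemma eval_pol_linear_form: "eval_pol (linear_form a) p = (\<Sum>i\<in>UNIV. a i * p i)"
proof -
  have "(\<Prod>l\<in>UNIV. p l ^ Poly_Mapping.lookup (Poly_Mapping.single i 1) l) = p i" for i :: 3
  proof -
    have "(\<Prod>l\<in>UNIV. p l ^ Poly_Mapping.lookup (Poly_Mapping.single i 1) l) = (\<Prod>l\<in>UNIV. if l = i then p l else 1)"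
      by (rule prod.cong) (auto simp: lookup_single)
    then show ?thesis by simp
  qed
  then show ?thesis
    by (simp add: linear_form_def eval_pol_single)
qed

section \<open>Graded pieces and linear forms\<close>

lemma mdeg_add: "mdeg (m + m') = mdeg m + mdeg m'"
  by (simp add: mdeg_def lookup_add sum.distrib)

lemma forms_0 [simp]: "0 \<in> forms n"
  by (simp add: forms_def)

lemma forms_single: "mdeg m = n \<Longrightarrow> Poly_Mapping.single m c \<in> forms n"
  by (auto simp: forms_def split: if_splits)

lemma forms_add: "f \<in> forms n \<Longrightarrow> g \<in> forms n \<Longrightarrow> f + g \<in> forms n"
  unfolding forms_def using Poly_Mapping.keys_add[of f g] by blast

lemma forms_mult: "f \<in> forms n \<Longrightarrow> g \<in> forms m \<Longrightarrow> f * g \<in> forms (n + m)"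
  unfolding forms_def using keys_mult[of f g] by (fastforce simp: mdeg_add)

lemma forms_cst: "cst c \<in> forms 0"
  unfolding cst_def by (rule forms_single) (simp add: mdeg_def)

lemma forms_cst_mult: "f \<in> forms n \<Longrightarrow> cst c * f \<in> forms n"
  using forms_mult[OF forms_cst] by fastforce

lemma forms_sum: "(\<And>i. i \<in> I \<Longrightarrow> f i \<in> forms n) \<Longrightarrow> (\<Sum>i\<in>I. f i) \<in> forms n"
  by (induction I rule: infinite_finite_induct) (auto intro: forms_add)

lemma forms_diff:
  fixes f g :: "'k::comm_ring_1 pol"
  assumes "f \<in> forms n" "g \<in> forms n"
  shows "f - g \<in> forms n"
proof -
  have "f - g = f + cst (- 1) * g"
    by (simp only: cst_def single_uminus single_one) simp
  then show ?thesis using assms by (metis forms_add forms_cst_mult)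
qed

lemma forms_1: "1 \<in> forms 0"
  by (simp add: forms_def mdeg_def)

lemma forms_prod:
  "(\<And>i. i \<in> I \<Longrightarrow> f i \<in> forms (e i)) \<Longrightarrow> (\<Prod>i\<in>I. f i :: 'k::comm_semiring_1 pol) \<in> forms (\<Sum>i\<in>I. e i)"
  by (induction I rule: infinite_finite_induct) (auto intro: forms_mult forms_1)

lemma forms_power: "f \<in> forms n \<Longrightarrow> (f :: 'k::comm_semiring_1 pol) ^ e \<in> forms (e * n)"
  using forms_prod[of "{..<e}" "\<lambda>_. f" "\<lambda>_. n"] by simp

lemma mdeg_single: "mdeg (Poly_Mapping.single i n) = n"
proof -
  have "mdeg (Poly_Mapping.single i n) = (\<Sum>l\<in>UNIV. if l = i then n else 0)"
    unfolding mdeg_def by (rule sum.cong) (auto simp: lookup_single)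
  then show ?thesis by simp
qed

lemma linear_form_forms: "linear_form a \<in> forms 1"
  unfolding linear_form_def by (intro forms_sum forms_single mdeg_single)

lemma inj_single_exponent: "Poly_Mapping.single x (Suc 0) = Poly_Mapping.single y (Suc 0) \<Longrightarrow> x = y"
  by (metis lookup_single_eq lookup_single_not_eq nat.distinct(1))

lemma lookup_linear_form:
  "Poly_Mapping.lookup (linear_form a) (Poly_Mapping.single i 1) = a i"
proof -
  have "Poly_Mapping.lookup (linear_form a) (Poly_Mapping.single i 1) = (\<Sum>l\<in>UNIV. if l = i then a i else 0)"
    unfolding linear_form_def lookup_sum
    by (rule sum.cong) (auto simp: lookup_single when_def dest: inj_single_exponent)
  then show ?thesis by simp
qed

section \<open>Derivatives of powers of linear forms\<close>

lemma partial_add: "partial i (f + g) = partial i f + partial i g"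
  unfolding partial_def
  by (rule sum_keys_add) (auto simp: single_add[symmetric] distrib_left)

lemma partial_0 [simp]: "partial i 0 = 0"
  by (simp add: partial_def)

lemma partial_single:
  "partial i (Poly_Mapping.single m c)
    = Poly_Mapping.single (m - Poly_Mapping.single i 1) (of_nat (Poly_Mapping.lookup m i) * c)"
  by (cases "c = 0") (simp_all add: partial_def)

lemma partial_mult: "partial i (f * g) = partial i f * g + f * partial i g"
proof (induction f rule: pol_induct)
  case (monomial m c)
  show ?case
  proof (induction g rule: pol_induct)
    case (monomial m' c')
    let ?e = "Poly_Mapping.single i (1::nat)"
    \<comment> \<open>Truncated subtraction commutes with adding the other exponent when variable
      \<open>i\<close> occurs in \<open>m\<close>; otherwise the coefficient is zero.\<close>
    have shift: "Poly_Mapping.single (m + m' - ?e) (of_nat (Poly_Mapping.lookup m i) * x)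
        = Poly_Mapping.single (m - ?e + m') (of_nat (Poly_Mapping.lookup m i) * x)"
      for m m' and x :: 'a
    proof (cases "Poly_Mapping.lookup m i = 0")
      case False
      then have "m + m' - ?e = m - ?e + m'"
        by (intro poly_mapping_eqI) (auto simp: lookup_add lookup_minus lookup_single when_def)
      then show ?thesis by simp
    qed simp
    show ?case
      using shift[of m m' "c * c'"] shift[of m' m "c * c'"]
      by (simp add: mult_single partial_single lookup_add single_add algebra_simps)
  qed (simp_all add: distrib_left partial_add algebra_simps)
qed (simp_all add: distrib_right partial_add algebra_simps)

lemma partial_cst [simp]: "partial i (cst c) = 0"
  by (simp add: cst_def partial_single)

lemma partial_cst_mult: "partial i (cst c * f) = cst c * partial i f"
  by (simp add: partial_mult)

lemma partial_sum: "partial i (\<Sum>l\<in>I. f l) = (\<Sum>l\<in>I. partial i (f l))"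
  by (induction I rule: infinite_finite_induct) (auto simp: partial_add)

lemma partial_linear_form: "partial i (linear_form a) = cst (a i)"
proof -
  have "partial i (linear_form a) = (\<Sum>l\<in>UNIV. if l = i then cst (a l) else 0)"
    unfolding linear_form_def partial_sum
    by (rule sum.cong) (auto simp: partial_single lookup_single cst_def)
  then show ?thesis by simp
qed

lemma cst_mult: "cst a * cst b = cst (a * b)"
  by (simp add: cst_def mult_single)

lemma cst_add: "cst a + cst b = cst (a + b)"
  by (simp add: cst_def single_add)

lemma cst_0 [simp]: "cst 0 = 0"
  by (simp add: cst_def)

lemma cst_1 [simp]: "cst 1 = 1"
  by (simp add: cst_def)

lemma partial_power: "partial i (f ^ Suc n) = cst (of_nat (Suc n)) * f ^ n * partial i f"
proof (induction n)
  case (Suc n)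
  have "partial i (f ^ Suc (Suc n)) = partial i f * f ^ Suc n + f * partial i (f ^ Suc n)"
    by (simp add: partial_mult)
  also have "\<dots> = (cst 1 + cst (of_nat (Suc n))) * f ^ Suc n * partial i f"
    unfolding Suc by (simp add: algebra_simps)
  also have "cst 1 + cst (of_nat (Suc n)) = (cst (of_nat (Suc (Suc n))) :: 'a pol)"
    unfolding cst_add by simp
  finally show ?case .
qed simp

lemma partial_funpow_linear:
  "(partial i ^^ r) (f + g) = (partial i ^^ r) f + (partial i ^^ r) g"
  "(partial i ^^ r) (cst c * f) = cst c * (partial i ^^ r) f"
  "(partial i ^^ r) 0 = 0"
  by (induction r) (simp_all add: partial_add partial_cst_mult)

text \<open>Each derivative multiplies by the current exponent and by \<open>a i\<close>; the
  resulting falling factorial is written as a quotient of factorials.\<close>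

lemma partial_funpow_linear_form_power:
  fixes a :: "3 \<Rightarrow> 'k::field_char_0"
  assumes "r \<le> n"
  shows "(partial i ^^ r) (linear_form a ^ n)
    = cst (fact n / fact (n - r) * a i ^ r) * linear_form a ^ (n - r)"
  using assms
proof (induction r)
  case (Suc r)
  then obtain l where l: "n - r = Suc l" "n - Suc r = l" by (metis Suc_diff_Suc Suc_le_lessD)
  have "(partial i ^^ Suc r) (linear_form a ^ n)
     = cst (fact n / fact (n - r) * a i ^ r) * partial i (linear_form a ^ Suc l)"
    using Suc l by (simp add: partial_cst_mult)
  also have "\<dots> = cst (fact n / fact (n - r) * a i ^ r * (of_nat (Suc l) * a i)) * linear_form a ^ l"
    by (simp only: partial_power partial_linear_form cst_mult[symmetric] mult_ac)
  also have "fact n / fact (n - r) * a i ^ r * (of_nat (Suc l) * a i) = fact n / fact l * a i ^ Suc r"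
    by (simp add: l field_simps del: of_nat_Suc)
  finally show ?case by (simp only: l)
qed simp

lemma UNIV_type_3: "(UNIV :: 3 set) = {0, 1, 2}"
proof -
  have "card {0, 1, 2 :: 3} = 3" by simp
  then show ?thesis by (intro card_subset_eq[symmetric]) auto
qed

lemma sum_type_3: "(\<Sum>i\<in>UNIV. h (i :: 3)) = h 0 + h 1 + h 2"
  and prod_type_3: "(\<Prod>i\<in>UNIV. h (i :: 3)) = h 0 * h 1 * h 2"
  unfolding UNIV_type_3 by (simp_all add: ac_simps)

lemma mono_act_linear:
  "mono_act m (f + g) = mono_act m f + mono_act m g"
  "mono_act m (cst c * f) = cst c * mono_act m f"
  "mono_act m 0 = 0"
  by (simp_all add: mono_act_def partial_funpow_linear)

lemma mono_act_linear_form_power: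
  fixes a :: "3 \<Rightarrow> 'k::field_char_0"
  assumes "mdeg m \<le> n"
  shows "mono_act m (linear_form a ^ n) =
    cst (fact n / fact (n - mdeg m) * (\<Prod>i\<in>UNIV. a i ^ Poly_Mapping.lookup m i))
      * linear_form a ^ (n - mdeg m)"
proof -
  define r s t where rst: "r = Poly_Mapping.lookup m 0" "s = Poly_Mapping.lookup m 1" "t = Poly_Mapping.lookup m 2"
  have m: "mdeg m = r + s + t" and pr: "(\<Prod>i\<in>UNIV. a i ^ Poly_Mapping.lookup m i) = a 0 ^ r * a 1 ^ s * a 2 ^ t"
    unfolding mdeg_def rst by (rule sum_type_3) (rule prod_type_3)
  have le: "t \<le> n" "s \<le> n - t" "r \<le> n - t - s" and eq: "n - t - s - r = n - mdeg m"
    using assms m by auto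
  let ?L = "linear_form a"
  have "mono_act m (?L ^ n) = cst (fact n / fact (n - t) * a 2 ^ t) *
      (cst (fact (n - t) / fact (n - t - s) * a 1 ^ s) *
      (cst (fact (n - t - s) / fact (n - t - s - r) * a 0 ^ r) * ?L ^ (n - t - s - r)))"
    unfolding mono_act_def rst[symmetric]
    by (simp only: partial_funpow_linear_form_power[OF le(1)] partial_funpow_linear_form_power[OF le(2)]
        partial_funpow_linear_form_power[OF le(3)] partial_funpow_linear(2))
  also have "\<dots> = cst (fact n / fact (n - t) * a 2 ^ t * (fact (n - t) / fact (n - t - s) * a 1 ^ s) *
      (fact (n - t - s) / fact (n - mdeg m) * a 0 ^ r)) * ?L ^ (n - mdeg m)"
    by (simp only: cst_mult[symmetric] mult.assoc eq)
  \<comment> \<open>The three falling factorials telescope.\<close>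
  also have "fact n / fact (n - t) * a 2 ^ t * (fact (n - t) / fact (n - t - s) * a 1 ^ s) *
      (fact (n - t - s) / fact (n - mdeg m) * a 0 ^ r)
      = fact n / fact (n - mdeg m) * (a 0 ^ r * a 1 ^ s * a 2 ^ t)"
    by simp
  finally show ?thesis by (simp only: pr)
qed

lemma act_add_right: "act g (f + f') = act g f + act g f'"
  by (simp add: act_def mono_act_linear distrib_left sum.distrib)

lemma act_cst_mult_right: "act g (cst c * f) = cst c * act g f"
  by (simp only: act_def mono_act_linear sum_distrib_left mult.left_commute[of "cst c"])

lemma act_0_right [simp]: "act g 0 = 0"
  by (simp add: act_def mono_act_linear)

lemma act_sum_right: "act g (\<Sum>i\<in>I. f i) = (\<Sum>i\<in>I. act g (f i))"
  by (induction I rule: infinite_finite_induct) (auto simp: act_add_right)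

text \<open>The apolarity identity. All monomials of \<open>g\<close> have degree \<open>j\<close>,
  so the factorial quotient and the remaining power are common to them, and the other factors add up
  to the value of \<open>g\<close> at \<open>a\<close>.\<close>

lemma act_linear_form_power:
  fixes a :: "3 \<Rightarrow> 'k::field_char_0"
  assumes "g \<in> forms j" "j \<le> n"
  shows "act g (linear_form a ^ n)
    = cst (fact n / fact (n - j) * eval_pol g a) * linear_form a ^ (n - j)"
proof -
  have "act g (linear_form a ^ n) =
    (\<Sum>m\<in>Poly_Mapping.keys g. cst (fact n / fact (n - j) *
      (Poly_Mapping.lookup g m * (\<Prod>i\<in>UNIV. a i ^ Poly_Mapping.lookup m i))) * linear_form a ^ (n - j))"
    unfolding act_def
  proof (rule sum.cong[OF refl])
    fix m assume "m \<in> Poly_Mapping.keys g"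
    then have m: "mdeg m = j" using assms by (simp add: forms_def)
    show "cst (Poly_Mapping.lookup g m) * mono_act m (linear_form a ^ n) =
       cst (fact n / fact (n - j) *
      (Poly_Mapping.lookup g m * (\<Prod>i\<in>UNIV. a i ^ Poly_Mapping.lookup m i))) * linear_form a ^ (n - j)"
      using mono_act_linear_form_power[of m n a] assms m
      by (simp only: mult.assoc[symmetric] cst_mult mult.commute[of "Poly_Mapping.lookup g m"])
        (simp add: mult_ac)
  qed
  also have "\<dots> = (\<Sum>m\<in>Poly_Mapping.keys g. cst (fact n / fact (n - j) *
      (Poly_Mapping.lookup g m * (\<Prod>i\<in>UNIV. a i ^ Poly_Mapping.lookup m i)))) * linear_form a ^ (n - j)"
    by (simp add: sum_distrib_right)
  also have "(\<Sum>m\<in>Poly_Mapping.keys g. cst (fact n / fact (n - j) *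
      (Poly_Mapping.lookup g m * (\<Prod>i\<in>UNIV. a i ^ Poly_Mapping.lookup m i))))
    = cst (fact n / fact (n - j) * eval_pol g a)"
  proof -
    have "(\<Sum>x\<in>I. cst (h x)) = cst (\<Sum>x\<in>I. h x)" for h :: "(3 \<Rightarrow>\<^sub>0 nat) \<Rightarrow> 'k" and I
      by (induction I rule: infinite_finite_induct) (auto simp: cst_add)
    then show ?thesis by (simp add: eval_pol_def sum_distrib_left)
  qed
  finally show ?thesis .
qed

lemma act_power_sum:
  fixes \<alpha> :: "(3 \<Rightarrow> 'k::field_char_0) \<Rightarrow> 'k"
  assumes "g \<in> forms j" "j \<le> d"
  shows "act g (\<Sum>p\<in>X. cst (\<alpha> p) * linear_form p ^ d)
    = cst (fact d / fact (d - j)) * (\<Sum>p\<in>X. cst (\<alpha> p * eval_pol g p) * linear_form p ^ (d - j))"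
  by (simp only: act_sum_right act_cst_mult_right act_linear_form_power[OF assms]
      sum_distrib_left cst_mult[symmetric] mult.assoc mult.left_commute[of "cst (\<alpha> _)"])

subsection \<open>Relations among the points\<close>

text \<open>Membership is a pointwise condition, without a span; on forms it agrees with
  \<open>vanishing_ideal X\<close>, by \<open>vanishing_ideal_forms\<close>.\<close>

definition vanishing :: "(3 \<Rightarrow> 'k::field) set \<Rightarrow> 'k pol set" where
  "vanishing X = {f. \<forall>p\<in>X. eval_pol f p = 0}"

text \<open>Every element whose membership is tested is itself a form of degree \<open>j\<close>.
  This allows \<open>Ann F\<close> and \<open>vanishing_ideal X\<close> to be replaced by
  \<open>vanishing X\<close> one degree at a time.\<close>

lemma quot_basis_cong:
  assumes "\<And>f. f \<in> forms j \<Longrightarrow> f \<in> I \<longleftrightarrow> f \<in> I'"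
  shows "quot_basis I j bs \<longleftrightarrow> quot_basis I' j bs"
proof (cases "set bs \<subseteq> forms j")
  case True
  have "(\<Sum>u<length bs. cst (c u) * bs ! u) \<in> forms j" for c
    using True by (intro forms_sum forms_cst_mult) auto
  then show ?thesis
    by (simp add: quot_basis_def assms forms_diff)
qed (simp add: quot_basis_def)

lemma hilbert_fun_cong:
  assumes "\<And>f. f \<in> forms j \<Longrightarrow> f \<in> I \<longleftrightarrow> f \<in> I'"
  shows "hilbert_fun I j = hilbert_fun I' j"
  using quot_basis_cong[OF assms] by (simp add: hilbert_fun_def)

text \<open>The exchange argument: expressing a longer list through a shorter one gives fewer
  equations than unknowns, hence a dependency. It makes the \<open>THE\<close> in
  \<open>hilbert_fun\<close> well defined.\<close>

lemma quot_basis_vanishing_length_le: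
  assumes "quot_basis (vanishing X) j bs" "quot_basis (vanishing X) j bs'"
  shows "length bs' \<le> length bs"
proof (rule ccontr)
  assume less: "\<not> length bs' \<le> length bs"
  have "\<forall>v\<in>{..<length bs'}. \<exists>c. bs' ! v - (\<Sum>u<length bs. cst (c u) * bs ! u) \<in> vanishing X"
  proof
    fix v assume "v \<in> {..<length bs'}"
    then have "bs' ! v \<in> forms j" using assms(2) by (auto simp: quot_basis_def)
    then show "\<exists>c. bs' ! v - (\<Sum>u<length bs. cst (c u) * bs ! u) \<in> vanishing X"
      using assms(1) unfolding quot_basis_def by blast
  qed
  from bchoice[OF this] obtain A where A: "\<And>v. v < length bs' \<Longrightarrow>
      bs' ! v - (\<Sum>u<length bs. cst (A v u) * bs ! u) \<in> vanishing X"
    by auto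
  obtain c where c: "\<exists>v<length bs'. c v \<noteq> 0" "\<And>u. u < length bs \<Longrightarrow> (\<Sum>v<length bs'. c v * A v u) = 0"
    using homogeneous_system_nontrivial[of "{..<length bs}" "{..<length bs'}" A] less by auto
  have "eval_pol (\<Sum>v<length bs'. cst (c v) * bs' ! v) p = 0" if p: "p \<in> X" for p
  proof -
    have "eval_pol (\<Sum>v<length bs'. cst (c v) * bs' ! v) p
        = (\<Sum>v<length bs'. \<Sum>u<length bs. c v * A v u * eval_pol (bs ! u) p)"
      using A p by (auto simp: vanishing_def sum_distrib_left mult.assoc intro!: sum.cong)
    also have "\<dots> = (\<Sum>u<length bs. (\<Sum>v<length bs'. c v * A v u) * eval_pol (bs ! u) p)"
      by (subst sum.swap) (simp add: sum_distrib_right)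
    finally show ?thesis using c(2) by simp
  qed
  then have "(\<Sum>v<length bs'. cst (c v) * bs' ! v) \<in> vanishing X" by (simp add: vanishing_def)
  then show False using assms(2) c(1) unfolding quot_basis_def by blast
qed

text \<open>By the last conjunct, \<open>T\<close> is a maximal subset of \<open>X\<close> imposing independent conditions on
  forms of degree \<open>n\<close>.\<close>

definition dual_forms ::
    "(3 \<Rightarrow> 'k::field) set \<Rightarrow> nat \<Rightarrow> (3 \<Rightarrow> 'k) set \<Rightarrow> ((3 \<Rightarrow> 'k) \<Rightarrow> 'k pol) \<Rightarrow> bool" where
  "dual_forms X n T G \<longleftrightarrow> T \<subseteq> X \<and> (\<forall>p\<in>T. G p \<in> forms n) \<and>
    (\<forall>p\<in>T. \<forall>q\<in>T. eval_pol (G p) q = (if p = q then 1 else 0)) \<and>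
    (\<forall>f\<in>forms n. (\<forall>p\<in>T. eval_pol f p = 0) \<longrightarrow> (\<forall>p\<in>X. eval_pol f p = 0))"

lemma dual_formsD:
  assumes "dual_forms X n T G"
  shows "T \<subseteq> X" "p \<in> T \<Longrightarrow> G p \<in> forms n"
    "p \<in> T \<Longrightarrow> q \<in> T \<Longrightarrow> eval_pol (G p) q = (if p = q then 1 else 0)"
    "f \<in> forms n \<Longrightarrow> (\<And>p. p \<in> T \<Longrightarrow> eval_pol f p = 0) \<Longrightarrow> p \<in> X \<Longrightarrow> eval_pol f p = 0"
  using assms by (auto simp: dual_forms_def)

text \<open>Points are added one at a time. Either the values on \<open>T\<close> already determine
  vanishing at \<open>x\<close>, or some form vanishes on \<open>T\<close> but not at
  \<open>x\<close>; scaled, it becomes the dual form of \<open>x\<close> and corrects the older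
  ones.\<close>

lemma dual_forms_exist:
  assumes "finite (X :: (3 \<Rightarrow> 'k::field) set)"
  shows "\<exists>T G. dual_forms X n T G"
  using assms
proof (induction X rule: finite_induct)
  case empty
  show ?case by (auto simp: dual_forms_def)
next
  case (insert x X)
  from insert.IH obtain T G where TG: "dual_forms X n T G" by blast
  note T = dual_formsD[OF TG]
  show ?case
  proof (cases "\<forall>f\<in>forms n. (\<forall>p\<in>T. eval_pol f p = 0) \<longrightarrow> eval_pol f x = 0")
    case True
    then have "dual_forms (insert x X) n T G"
      using TG unfolding dual_forms_def by blast
    then show ?thesis by blast
  next
    case False
    then obtain f0 where f0: "f0 \<in> forms n" "\<And>p. p \<in> T \<Longrightarrow> eval_pol f0 p = 0" "eval_pol f0 x \<noteq> 0"
      by blast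
    define f where "f = cst (1 / eval_pol f0 x) * f0"
    have f: "f \<in> forms n" "\<And>p. p \<in> T \<Longrightarrow> eval_pol f p = 0" "eval_pol f x = 1"
      using f0 by (auto simp: f_def forms_cst_mult)
    define G' where "G' p = (if p = x then f else G p - cst (eval_pol (G p) x) * f)" for p
    have x: "x \<notin> T" using T insert.hyps by blast
    have "dual_forms (insert x X) n (insert x T) G'"
      unfolding dual_forms_def
    proof (intro conjI ballI impI)
      show "insert x T \<subseteq> insert x X" using T by blast
      show "G' p \<in> forms n" if "p \<in> insert x T" for p
        using that T(2) f by (auto simp: G'_def intro!: forms_diff forms_cst_mult)
      show "eval_pol (G' p) q = (if p = q then 1 else 0)" if "p \<in> insert x T" "q \<in> insert x T" for p q
        using that T(3) f x by (auto simp: G'_def)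
      show "eval_pol h p = 0"
        if "h \<in> forms n" "\<forall>p\<in>insert x T. eval_pol h p = 0" "p \<in> insert x X" for h p
        using that T(4)[of h] by auto
    qed
    then show ?thesis by blast
  qed
qed

text \<open>The dual forms are a basis modulo forms vanishing on \<open>X\<close>: the coefficients
  of a form are its values on \<open>T\<close>.\<close>

lemma hilbert_fun_vanishing_dual_forms:
  assumes X: "finite (X :: (3 \<Rightarrow> 'k::field) set)"
  obtains T G where "dual_forms X n T G" "card T = hilbert_fun (vanishing X) n" "finite T"
proof -
  obtain T G where TG: "dual_forms X n T G"
    using dual_forms_exist[OF X, of n] by blast
  note T = dual_formsD[OF TG]
  have fT: "finite T" using T(1) X finite_subset by blast
  then obtain e where e: "bij_betw e {..<card T} T"
    using ex_bij_betw_nat_finite[OF fT] by (auto simp: atLeast0LessThan)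
  define bs where "bs = map (\<lambda>u. G (e u)) [0..<card T]"
  have len: "length bs = card T" by (simp add: bs_def)
  have eT: "e u \<in> T" if "u < card T" for u using e that by (auto simp: bij_betw_def)
  have ev: "eval_pol (\<Sum>u<length bs. cst (c u) * bs ! u) (e v) = c v" if v: "v < card T" for c v
  proof -
    have "eval_pol (\<Sum>u<length bs. cst (c u) * bs ! u) (e v) = (\<Sum>u<card T. if u = v then c u else 0)"
      unfolding eval_pol_sum len
    proof (rule sum.cong[OF refl])
      fix u assume "u \<in> {..<card T}"
      then have u: "u < card T" by simp
      have "e u = e v \<longleftrightarrow> u = v" using e u v by (auto simp: bij_betw_def inj_on_def)
      then show "eval_pol (cst (c u) * bs ! u) (e v) = (if u = v then c u else 0)"
        using T(3)[OF eT[OF u] eT[OF v]] u by (simp add: bs_def)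
    qed
    then show ?thesis using v by simp
  qed
  have "quot_basis (vanishing X) n bs"
    unfolding quot_basis_def
  proof (intro conjI allI impI ballI)
    show bs: "set bs \<subseteq> forms n" using T(2) eT by (auto simp: bs_def)
    show "c u = 0" if "(\<Sum>u<length bs. cst (c u) * bs ! u) \<in> vanishing X" "u < length bs" for c u
      using that ev[of u c] eT[of u] T(1) len by (auto simp: vanishing_def)
    fix f :: "'k pol" assume f: "f \<in> forms n"
    let ?c = "\<lambda>u. eval_pol f (e u)"
    let ?g = "f - (\<Sum>u<length bs. cst (?c u) * bs ! u)"
    have "?g \<in> forms n"
      using f bs by (intro forms_diff forms_sum forms_cst_mult) auto
    moreover have "eval_pol ?g p = 0" if "p \<in> T" for p
    proof -
      have "p \<in> e ` {..<card T}" using e that by (simp add: bij_betw_def)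
      then obtain v where "v < card T" "p = e v" by auto
      then show ?thesis using ev[of v ?c] by simp
    qed
    ultimately have "?g \<in> vanishing X" using T(4)[of ?g] unfolding vanishing_def by blast
    then show "\<exists>c. f - (\<Sum>u<length bs. cst (c u) * bs ! u) \<in> vanishing X"
      by (intro exI[of _ ?c])
  qed
  then have "hilbert_fun (vanishing X) n = length bs"
    unfolding hilbert_fun_def
    by (intro the_equality) (auto intro: le_antisym quot_basis_vanishing_length_le)
  then show ?thesis using that[OF TG _ fT] len by simp
qed

text \<open>The orthogonal complement of the value vectors of forms of degree \<open>n\<close>; on
  \<open>X\<close> its dimension is \<open>card X\<close> minus the Hilbert function.\<close>

definition relation :: "(3 \<Rightarrow> 'k::field) set \<Rightarrow> nat \<Rightarrow> ((3 \<Rightarrow> 'k) \<Rightarrow> 'k) \<Rightarrow> bool" where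
  "relation X n \<nu> \<longleftrightarrow> (\<forall>g\<in>forms n. (\<Sum>p\<in>X. \<nu> p * eval_pol g p) = 0)"

lemma relation_mult_form:
  assumes "relation X (m + n) \<nu>" "g \<in> forms m"
  shows "relation X n (\<lambda>p. \<nu> p * eval_pol g p)"
  using assms by (auto simp: relation_def mult.assoc simp flip: eval_pol_mult intro: forms_mult)

text \<open>A relation is determined by its values off \<open>T\<close>: if these vanish, testing
  against \<open>G p\<close> reads off the value at \<open>p\<close> in \<open>T\<close>. So only
  \<open>card X - card T\<close> equations have to be solved.\<close>

lemma relations_dependent:
  assumes X: "finite (X :: (3 \<Rightarrow> 'k::field) set)" and K: "finite K"
    and card: "card X < hilbert_fun (vanishing X) n + card K"
    and rel: "\<And>i. i \<in> K \<Longrightarrow> relation X n (\<nu> i)"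
  shows "\<exists>c. (\<exists>i\<in>K. c i \<noteq> 0) \<and> (\<forall>p\<in>X. (\<Sum>i\<in>K. c i * \<nu> i p) = 0)"
proof -
  obtain T G where TG: "dual_forms X n T G" "card T = hilbert_fun (vanishing X) n" and fT: "finite T"
    using hilbert_fun_vanishing_dual_forms[OF X, of n] by blast
  note T = dual_formsD(1)[OF TG(1)] TG(2) dual_formsD(2-4)[OF TG(1)]
  have "card (X - T) < card K"
    using card T(1,2) X card_mono[OF X T(1)] by (simp add: card_Diff_subset[OF fT])
  then obtain c where c: "\<exists>i\<in>K. c i \<noteq> 0" "\<And>p. p \<in> X - T \<Longrightarrow> (\<Sum>i\<in>K. c i * \<nu> i p) = 0"
    using homogeneous_system_nontrivial[of "X - T" K \<nu>] X K by auto
  have "(\<Sum>i\<in>K. c i * \<nu> i p) = 0" if p: "p \<in> T" for p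
  proof -
    let ?\<mu> = "\<lambda>q. \<Sum>i\<in>K. c i * \<nu> i q"
    have "(\<Sum>q\<in>X. ?\<mu> q * eval_pol (G p) q) = (\<Sum>i\<in>K. c i * (\<Sum>q\<in>X. \<nu> i q * eval_pol (G p) q))"
      by (simp add: sum_distrib_right sum_distrib_left mult.assoc) (rule sum.swap)
    also have "\<dots> = 0" using rel T(3)[OF p] by (simp add: relation_def)
    also have "(\<Sum>q\<in>X. ?\<mu> q * eval_pol (G p) q) = (\<Sum>q\<in>T. ?\<mu> q * eval_pol (G p) q)"
      using T(1) X c(2) by (intro sum.mono_neutral_right) auto
    also have "\<dots> = (\<Sum>q\<in>T. if q = p then ?\<mu> q else 0)"
      using T(4) p by (intro sum.cong) auto
    also have "\<dots> = ?\<mu> p" using fT p by simp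
    finally show ?thesis .
  qed
  then show ?thesis using c by blast
qed

text \<open>Evaluation at a point \<open>x\<close> outside \<open>T\<close> is the combination of
  the evaluations on \<open>T\<close> with coefficients \<open>eval_pol (G p) x\<close>; this is the
  relation.\<close>

lemma nontrivial_relation_exists:
  assumes X: "finite (X :: (3 \<Rightarrow> 'k::field) set)" and less: "hilbert_fun (vanishing X) n < card X"
  obtains \<nu> where "relation X n \<nu>" "\<exists>p\<in>X. \<nu> p \<noteq> 0"
proof -
  obtain T G where TG: "dual_forms X n T G" "card T = hilbert_fun (vanishing X) n" and fT: "finite T"
    using hilbert_fun_vanishing_dual_forms[OF X, of n] by blast
  note T = dual_formsD(1)[OF TG(1)] TG(2) dual_formsD(2-4)[OF TG(1)]
  obtain x where x: "x \<in> X" "x \<notin> T" using T less by (metis less_irrefl subsetI subset_antisym)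
  define \<nu> where "\<nu> p = (if p = x then 1 else if p \<in> T then - eval_pol (G p) x else 0)" for p
  have "(\<Sum>p\<in>X. \<nu> p * eval_pol g p) = 0" if g: "g \<in> forms n" for g
  proof -
    let ?h = "g - (\<Sum>p\<in>T. cst (eval_pol g p) * G p)"
    have "?h \<in> forms n" using g T by (intro forms_diff forms_sum forms_cst_mult) auto
    moreover have "eval_pol ?h q = 0" if q: "q \<in> T" for q
    proof -
      have "(\<Sum>p\<in>T. eval_pol g p * eval_pol (G p) q) = (\<Sum>p\<in>T. if p = q then eval_pol g p else 0)"
        using T(4) q by (intro sum.cong) auto
      then show ?thesis using fT q by simp
    qed
    ultimately have "eval_pol ?h x = 0" using T(5) x by blast
    then have *: "eval_pol g x = (\<Sum>p\<in>T. eval_pol g p * eval_pol (G p) x)" by simp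
    have "(\<Sum>p\<in>X. \<nu> p * eval_pol g p) = (\<Sum>p\<in>insert x T. \<nu> p * eval_pol g p)"
      using T(1) X x by (intro sum.mono_neutral_right) (auto simp: \<nu>_def)
    also have "\<dots> = eval_pol g x + (\<Sum>p\<in>T. - eval_pol (G p) x * eval_pol g p)"
      using fT x by (auto simp: \<nu>_def intro!: sum.cong)
    also have "\<dots> = 0" by (simp add: * sum_negf mult.commute)
    finally show ?thesis .
  qed
  then have "relation X n \<nu>" by (simp add: relation_def)
  moreover have "\<nu> x \<noteq> 0" by (simp add: \<nu>_def)
  ultimately show ?thesis using that x(1) by blast
qed

lemma relation_trivial:
  assumes X: "finite (X :: (3 \<Rightarrow> 'k::field) set)" and eq: "hilbert_fun (vanishing X) n = card X"
    and rel: "relation X n \<nu>" and p: "p \<in> X"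
  shows "\<nu> p = 0"
  using relations_dependent[OF X, of "{()}" n "\<lambda>_. \<nu>"] eq rel p by auto

section \<open>Linear forms separating points\<close>

lemma exists_coordinate_nonzero:
  assumes "p \<noteq> (\<lambda>_. 0)"
  obtains i where "p i \<noteq> 0"
  using assms by (auto simp: fun_eq_iff)

lemma eval_pol_coordinate:
  "eval_pol (linear_form (\<lambda>l. if l = i then 1 else 0)) p = (p i :: 'k::field)"
proof -
  have "eval_pol (linear_form (\<lambda>l. if l = i then 1 else 0)) p = (\<Sum>l\<in>UNIV. if l = i then p l else 0)"
    unfolding eval_pol_linear_form by (rule sum.cong) auto
  then show ?thesis by simp
qed

lemma linear_form_nonzero_at:
  fixes p :: "3 \<Rightarrow> 'k::field"
  assumes "p \<noteq> (\<lambda>_. 0)"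
  obtains y where "y \<in> forms 1" "eval_pol y p \<noteq> 0"
proof -
  obtain i where i: "p i \<noteq> 0" using assms by (rule exists_coordinate_nonzero)
  then show ?thesis using that[OF linear_form_forms] eval_pol_coordinate by metis
qed

text \<open>Multiplying by a power of a linear form that is nonzero at \<open>p\<close> lowers the
  degree to \<open>n\<close> without losing the value at \<open>p\<close>.\<close>

lemma relation_trivial_above:
  assumes X: "finite (X :: (3 \<Rightarrow> 'k::field) set)" and eq: "hilbert_fun (vanishing X) n = card X"
    and nz: "(\<lambda>_. 0) \<notin> X" and rel: "relation X j \<nu>" and j: "n \<le> j" and p: "p \<in> X"
  shows "\<nu> p = 0"
proof -
  obtain y where y: "y \<in> forms 1" "eval_pol y p \<noteq> 0"
    using linear_form_nonzero_at[of p] nz p by metis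
  have "relation X n (\<lambda>q. \<nu> q * eval_pol (y ^ (j - n)) q)"
    using rel j forms_power[OF y(1), of "j - n"] by (intro relation_mult_form[of _ "j - n"]) auto
  from relation_trivial[OF X eq this p] show ?thesis using y by simp
qed

text \<open>The form is a 2-by-2 minor of the two coordinate vectors involving an index where
  \<open>q\<close> is nonzero; if all such minors vanished, \<open>p\<close> would be a multiple of
  \<open>q\<close>.\<close>

lemma separating_linear_form:
  assumes "p \<noteq> (\<lambda>_. 0)" "q \<noteq> (\<lambda>_. 0)" "\<not> same_point q p"
  obtains y where "y \<in> forms 1" "eval_pol y q = 0" "eval_pol y p \<noteq> 0"
proof -
  obtain u where u: "q u \<noteq> 0" using assms(2) by (rule exists_coordinate_nonzero)
  have "\<exists>v. q u * p v \<noteq> q v * p u"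
  proof (rule ccontr)
    assume "\<not> ?thesis"
    then have eq: "p v = p u / q u * q v" for v using u by (simp add: field_simps)
    then have "p u \<noteq> 0" using assms(1) by (metis divide_eq_0_iff ext mult_zero_left)
    then show False using assms(3) eq u unfolding same_point_def by (metis divide_eq_0_iff)
  qed
  then obtain v where v: "q u * p v \<noteq> q v * p u" by blast
  then have uv: "u \<noteq> v" by auto
  define a where "a l = (if l = v then q u else if l = u then - q v else 0)" for l
  have ev: "eval_pol (linear_form a) r = q u * r v - q v * r u" for r
  proof -
    have "eval_pol (linear_form a) r
        = (\<Sum>l\<in>UNIV. (if l = v then q u * r l else 0) - (if l = u then q v * r l else 0))"
      unfolding eval_pol_linear_form by (rule sum.cong) (use uv in \<open>auto simp: a_def\<close>)
    then show ?thesis by (simp add: sum_subtractf)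
  qed
  show ?thesis using that[OF linear_form_forms, of a] v by (simp add: ev mult.commute)
qed

text \<open>Points are named by their coordinate vectors, so that weights and relations are
  functions on vectors.\<close>

definition projective_set :: "(3 \<Rightarrow> 'k::field) set \<Rightarrow> bool" where
  "projective_set X \<longleftrightarrow> finite X \<and> (\<lambda>_. 0) \<notin> X \<and> (\<forall>p\<in>X. \<forall>q\<in>X. same_point p q \<longrightarrow> p = q)"

text \<open>A product of linear forms, one through each other point, isolates any given point. Hence
  the \<open>LEAST\<close> defining \<open>tau\<close> is attained.\<close>

lemma hilbert_fun_eventually_card:
  assumes X: "projective_set X"
  shows "hilbert_fun (vanishing X) (card X - 1) = card X"
proof -
  have fX: "finite X" using X by (simp add: projective_set_def)
  obtain T G where TG: "dual_forms X (card X - 1) T G" "card T = hilbert_fun (vanishing X) (card X - 1)" and fT: "finite T"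
    using hilbert_fun_vanishing_dual_forms[OF fX, of "card X - 1"] by blast
  note T = dual_formsD(1)[OF TG(1)] TG(2) dual_formsD(2-4)[OF TG(1)]
  have "p \<in> T" if p: "p \<in> X" for p
  proof (rule ccontr)
    assume pT: "p \<notin> T"
    have "\<forall>q\<in>X - {p}. \<exists>y. y \<in> forms 1 \<and> eval_pol y q = 0 \<and> eval_pol y p \<noteq> 0"
    proof
      fix q assume q: "q \<in> X - {p}"
      have "p \<noteq> (\<lambda>_. 0)" "q \<noteq> (\<lambda>_. 0)" "\<not> same_point q p"
        using q X p unfolding projective_set_def by auto
      from separating_linear_form[OF this]
      show "\<exists>y. y \<in> forms 1 \<and> eval_pol y q = 0 \<and> eval_pol y p \<noteq> 0" by blast
    qed
    from bchoice[OF this] obtain y where y: "\<And>q. q \<in> X - {p} \<Longrightarrow> y q \<in> forms 1"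
        "\<And>q. q \<in> X - {p} \<Longrightarrow> eval_pol (y q) q = 0" "\<And>q. q \<in> X - {p} \<Longrightarrow> eval_pol (y q) p \<noteq> 0"
      by auto
    let ?f = "\<Prod>q\<in>X - {p}. y q"
    have "?f \<in> forms (\<Sum>q\<in>X - {p}. 1)" by (rule forms_prod) (rule y)
    then have "?f \<in> forms (card X - 1)" using fX p by simp
    moreover have "eval_pol ?f q = 0" if "q \<in> T" for q
      using that T(1) pT fX y(2)[of q] by auto
    ultimately have "eval_pol ?f p = 0" using T(5) p by blast
    then show False using fX y(3) by auto
  qed
  then show ?thesis using T by (metis subsetI subset_antisym)
qed

subsection \<open>Restriction to a line\<close>

lemma eval_pol_homogeneous:
  assumes "f \<in> forms j"
  shows "eval_pol f (\<lambda>i. w * v i) = w ^ j * eval_pol f v"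
proof -
  have "(\<Prod>i\<in>UNIV. (w * v i) ^ Poly_Mapping.lookup m i) = w ^ j * (\<Prod>i\<in>UNIV. v i ^ Poly_Mapping.lookup m i)"
    if "m \<in> Poly_Mapping.keys f" for m
  proof -
    have "(\<Prod>i\<in>UNIV. (w * v i) ^ Poly_Mapping.lookup m i)
        = w ^ mdeg m * (\<Prod>i\<in>UNIV. v i ^ Poly_Mapping.lookup m i)"
      by (simp add: power_mult_distrib prod.distrib mdeg_def power_sum)
    then show ?thesis using assms that by (simp add: forms_def)
  qed
  then show ?thesis
    by (simp add: eval_pol_def sum_distrib_left mult.left_commute)
qed

lemma restriction_to_line:
  fixes f :: "'k::field pol"
  assumes "f \<in> forms j"
  obtains q where "degree q \<le> j" "\<And>t. poly q t = eval_pol f (\<lambda>i. A i + t * B i)"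
proof
  let ?q = "\<Sum>m\<in>Poly_Mapping.keys f. smult (Poly_Mapping.lookup f m)
    (\<Prod>i\<in>UNIV. [:A i, B i:] ^ Poly_Mapping.lookup m i)"
  show "poly ?q t = eval_pol f (\<lambda>i. A i + t * B i)" for t
    by (simp add: eval_pol_def poly_sum poly_prod)
  show "degree ?q \<le> j"
  proof (rule degree_sum_le)
    fix m assume "m \<in> Poly_Mapping.keys f"
    then have m: "mdeg m = j" using assms by (simp add: forms_def)
    have "degree (\<Prod>i\<in>UNIV. [:A i, B i:] ^ Poly_Mapping.lookup m i)
        \<le> (\<Sum>i\<in>UNIV. degree ([:A i, B i:] ^ Poly_Mapping.lookup m i))"
      using degree_prod_sum_le[of UNIV "\<lambda>i. [:A i, B i:] ^ Poly_Mapping.lookup m i"] by (simp add: o_def)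
    also have "\<dots> \<le> (\<Sum>i\<in>UNIV. Poly_Mapping.lookup m i)"
    proof (rule sum_mono)
      fix i
      have "degree ([:A i, B i:] ^ Poly_Mapping.lookup m i) \<le> degree [:A i, B i:] * Poly_Mapping.lookup m i"
        by (rule degree_power_le)
      also have "\<dots> \<le> 1 * Poly_Mapping.lookup m i" by (intro mult_right_mono) auto
      finally show "degree ([:A i, B i:] ^ Poly_Mapping.lookup m i) \<le> Poly_Mapping.lookup m i" by simp
    qed
    finally show "degree (smult (Poly_Mapping.lookup f m)
        (\<Prod>i\<in>UNIV. [:A i, B i:] ^ Poly_Mapping.lookup m i)) \<le> j"
      using m degree_smult_le order_trans unfolding mdeg_def by blast
  qed simp
qed

lemma projective_set_subset: "projective_set X \<Longrightarrow> Z \<subseteq> X \<Longrightarrow> projective_set Z"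
  by (auto simp: projective_set_def intro: finite_subset)

text \<open>An affine coordinate \<open>t = y/w\<close> on a projective line, with its pole away from \<open>Z\<close>.\<close>

lemma line_parametrization:
  fixes Z :: "(3 \<Rightarrow> 'k::field_char_0) set"
  assumes Z: "projective_set Z" and c: "c \<noteq> (\<lambda>_. 0)"
    and line: "\<And>p. p \<in> Z \<Longrightarrow> (\<Sum>i\<in>UNIV. c i * p i) = 0"
  obtains A B w y t where
    "\<And>p. p \<in> Z \<Longrightarrow> eval_pol (linear_form w) p \<noteq> 0"
    "\<And>p. p \<in> Z \<Longrightarrow> eval_pol (linear_form y) p = eval_pol (linear_form w) p * t p"
    "\<And>p. p \<in> Z \<Longrightarrow> p = (\<lambda>i. eval_pol (linear_form w) p * (A i + t p * B i))"
    "inj_on t Z"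
proof -
  have fZ: "finite Z" and nz: "(\<lambda>_. 0) \<notin> Z" and sp: "\<And>p q. p \<in> Z \<Longrightarrow> q \<in> Z \<Longrightarrow> same_point p q \<Longrightarrow> p = q"
    using Z by (auto simp: projective_set_def)
  \<comment> \<open>The equation of the line is solved for a coordinate \<open>l\<close> with
    nonzero coefficient; the other two, \<open>u\<close> and \<open>v\<close>, parametrize.\<close>
  have "\<exists>A0 B0 u v. \<forall>p\<in>Z. \<forall>i. p i = p u * A0 i + p v * (B0 i :: 'k)"
  proof -
    obtain l where l: "c l \<noteq> 0" using c by (rule exists_coordinate_nonzero)
    have "card (UNIV - {l}) = 2" by simp
    then obtain u v where "UNIV - {l} = {u, v}" "u \<noteq> v" unfolding card_2_iff by blast
    then have uv: "u \<noteq> l" "v \<noteq> l" "u \<noteq> v" "\<And>i. i = l \<or> i = u \<or> i = v" by blast+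
    then have U: "UNIV = {l, u, v}" by blast
    have pl: "p l = - (c u * p u + c v * p v) / c l" if "p \<in> Z" for p
    proof -
      have "c l * p l + (c u * p u + c v * p v) = 0"
        using line[OF that] uv(1-3) unfolding U by (auto simp: add.assoc)
      then show ?thesis using l by (simp add: field_simps eq_neg_iff_add_eq_0)
    qed
    let ?A = "\<lambda>i. if i = l then - c u / c l else if i = u then 1 else 0"
    let ?B = "\<lambda>i. if i = l then - c v / c l else if i = v then 1 else 0"
    have "p i = p u * ?A i + p v * ?B i" if "p \<in> Z" for p i
      using uv(1-3) uv(4)[of i] pl[OF that] l by (auto simp: field_simps)
    then show ?thesis
      by (intro exI[of _ ?A] exI[of _ ?B] exI[of _ u] exI[of _ v]) blast
  qed
  then obtain A0 B0 :: "3 \<Rightarrow> 'k" and u v where AB: "\<And>p i. p \<in> Z \<Longrightarrow> p i = p u * A0 i + p v * B0 i"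
    by blast
  \<comment> \<open>This keeps \<open>p u + r * p v\<close> away from zero on \<open>Z\<close>;
    points with \<open>p v = 0\<close> are safe because there \<open>p u\<close> is nonzero.\<close>
  obtain r where r: "r \<notin> (\<lambda>p. - p u / p v) ` Z"
    using finite_avoid[of "(\<lambda>p. - p u / p v) ` Z"] fZ by auto
  define \<omega> where "\<omega> p = p u + r * p v" for p
  define t where "t p = p v / \<omega> p" for p
  define w :: "3 \<Rightarrow> 'k" where "w i = (if i = u then 1 else 0) + (if i = v then r else 0)" for i
  define y :: "3 \<Rightarrow> 'k" where "y i = (if i = v then 1 else 0)" for i
  have ew: "eval_pol (linear_form w) p = \<omega> p" for p
  proof -
    have "eval_pol (linear_form w) p = (\<Sum>i\<in>UNIV. (if i = u then p i else 0) + (if i = v then r * p i else 0))"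
      unfolding eval_pol_linear_form by (rule sum.cong) (auto simp: w_def algebra_simps)
    then show ?thesis by (simp add: sum.distrib \<omega>_def)
  qed
  have ey: "eval_pol (linear_form y) p = p v" for p
    unfolding y_def by (rule eval_pol_coordinate)
  have \<omega>0: "\<omega> p \<noteq> 0" if p: "p \<in> Z" for p
  proof
    assume 0: "\<omega> p = 0"
    show False
    proof (cases "p v = 0")
      case True
      then have pu: "p u = 0" using 0 by (simp add: \<omega>_def)
      have "p i = 0" for i using AB[OF p, of i] True pu by simp
      then have "p = (\<lambda>_. 0)" by (rule ext)
      then show False using nz p by blast
    next
      case False
      then have "r = - p u / p v" using 0 by (simp add: \<omega>_def field_simps eq_neg_iff_add_eq_0)
      then show False using r p by blast
    qed
  qed
  \<comment> \<open>Comes from substituting \<open>\<omega> p - r * p v\<close> for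
    \<open>p u\<close>.\<close>
  define B where "B i = B0 i - r * A0 i" for i
  have param: "p i = \<omega> p * (A0 i + t p * B i)" if p: "p \<in> Z" for p i
  proof -
    have "\<omega> p * (A0 i + t p * B i) = \<omega> p * A0 i + p v * B i"
      using \<omega>0[OF p] by (simp add: t_def field_simps)
    also have "\<dots> = p u * A0 i + p v * B0 i" by (simp add: \<omega>_def B_def algebra_simps)
    finally show ?thesis using AB[OF p, of i] by (rule trans[OF _ sym, rotated])
  qed
  have "inj_on t Z"
  proof (rule inj_onI)
    fix p q assume pq: "p \<in> Z" "q \<in> Z" "t p = t q"
    have "q i = \<omega> q / \<omega> p * p i" for i
      using param[OF pq(1), of i] param[OF pq(2), of i] \<omega>0[OF pq(1)] pq(3) by simp
    then have "same_point p q"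
      unfolding same_point_def using \<omega>0 pq by (intro exI[of _ "\<omega> q / \<omega> p"]) auto
    then show "p = q" using sp pq by blast
  qed
  moreover have "p = (\<lambda>i. \<omega> p * (A0 i + t p * B i))" if "p \<in> Z" for p
    using param[OF that] by (rule ext)
  moreover have "p v = \<omega> p * t p" if "p \<in> Z" for p
    using \<omega>0[OF that] by (simp add: t_def)
  ultimately show ?thesis
    using that[of w y t A0 B] \<omega>0 unfolding ew ey by blast
qed

subsection \<open>Relations supported on a line\<close>

text \<open>The products of \<open>\<nu>\<close> with the three coordinates are relations in degree
  \<open>n\<close>, hence dependent by \<open>h\<close>. The dependency multiplies
  \<open>\<nu> p\<close> by a linear form in \<open>p\<close>, which must vanish on the
  support.\<close>

lemma relation_diff_supported_on_line:
  fixes X :: "(3 \<Rightarrow> 'k::field) set"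
  assumes X: "finite X" and rel: "relation X (Suc n) \<nu>"
    and h: "card X \<le> hilbert_fun (vanishing X) n + 2"
  obtains c where "c \<noteq> (\<lambda>_. 0)" "\<And>p. p \<in> X \<Longrightarrow> \<nu> p \<noteq> 0 \<Longrightarrow> (\<Sum>i\<in>UNIV. c i * p i) = 0"
proof -
  have "relation X n (\<lambda>p. \<nu> p * p i)" for i
  proof -
    have "relation X n (\<lambda>p. \<nu> p * eval_pol (linear_form (\<lambda>l. if l = i then 1 else 0)) p)"
      using rel by (intro relation_mult_form[of _ 1] linear_form_forms) simp
    then show ?thesis by (simp only: eval_pol_coordinate)
  qed
  then obtain c where c: "\<exists>i\<in>(UNIV :: 3 set). c i \<noteq> 0" "\<forall>p\<in>X. (\<Sum>i\<in>UNIV. c i * (\<nu> p * p i)) = 0"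
    using relations_dependent[OF X, of "UNIV :: 3 set" n "\<lambda>i p. \<nu> p * p i"] h by auto
  show ?thesis
  proof (rule that)
    show "c \<noteq> (\<lambda>_. 0)" using c(1) by auto
    fix p assume p: "p \<in> X" "\<nu> p \<noteq> 0"
    have "\<nu> p * (\<Sum>i\<in>UNIV. c i * p i) = 0"
      using c(2) p(1) by (simp add: sum_distrib_left mult.left_commute)
    then show "(\<Sum>i\<in>UNIV. c i * p i) = 0" using p(2) by simp
  qed
qed

text \<open>On a smaller collinear support, a product of linear forms through all support points but
  \<open>z\<close>, padded to degree \<open>n\<close> by powers of \<open>w\<close>, would isolate
  \<open>z\<close>.\<close>

lemma relation_support_card:
  fixes X :: "(3 \<Rightarrow> 'k::field) set"
  assumes X: "finite X" and rel: "relation X n \<nu>" and nz: "\<exists>p\<in>X. \<nu> p \<noteq> 0"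
    and w: "\<And>p. p \<in> X \<Longrightarrow> \<nu> p \<noteq> 0 \<Longrightarrow> eval_pol (linear_form w) p \<noteq> 0"
    and y: "\<And>p. p \<in> X \<Longrightarrow> \<nu> p \<noteq> 0 \<Longrightarrow> eval_pol (linear_form y) p = eval_pol (linear_form w) p * t p"
    and inj: "inj_on t {p\<in>X. \<nu> p \<noteq> 0}"
  shows "n + 2 \<le> card {p\<in>X. \<nu> p \<noteq> 0}"
proof (rule ccontr)
  let ?Z = "{p\<in>X. \<nu> p \<noteq> 0}"
  assume "\<not> ?thesis"
  then have card: "card ?Z \<le> n + 1" by simp
  obtain z where z: "z \<in> ?Z" using nz by blast
  have fZ: "finite ?Z" using X by simp
  let ?l = "\<lambda>q. linear_form y - cst (t q) * linear_form w"
  let ?g = "linear_form w ^ (n - (card ?Z - 1)) * (\<Prod>q\<in>?Z - {z}. ?l q)"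
  have "(\<Prod>q\<in>?Z - {z}. ?l q) \<in> forms (\<Sum>q\<in>?Z - {z}. 1)"
    by (intro forms_prod forms_diff forms_cst_mult linear_form_forms)
  moreover have "(\<Sum>q\<in>?Z - {z}. 1) = card ?Z - 1" using fZ z by simp
  ultimately have "?g \<in> forms ((n - (card ?Z - 1)) * 1 + (card ?Z - 1))"
    by (intro forms_mult forms_power linear_form_forms) simp
  then have g: "?g \<in> forms n" using card by simp
  have el: "eval_pol (?l q) p = eval_pol (linear_form w) p * (t p - t q)" if "p \<in> ?Z" for p q
    using y[of p] that by (simp add: algebra_simps)
  have "(\<Sum>p\<in>X. \<nu> p * eval_pol ?g p) = (\<Sum>p\<in>{z}. \<nu> p * eval_pol ?g p)"
  proof (intro sum.mono_neutral_right ballI)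
    fix p assume p: "p \<in> X - {z}"
    show "\<nu> p * eval_pol ?g p = 0"
    proof (cases "\<nu> p = 0")
      case False
      then have "\<exists>q\<in>?Z - {z}. eval_pol (?l q) p = 0" using el[of p p] p by (intro bexI[of _ p]) auto
      then show ?thesis using fZ by simp
    qed simp
  qed (use X z in auto)
  then have "eval_pol ?g z = 0" using rel g z by (auto simp: relation_def simp del: eval_pol_mult)
  moreover have "eval_pol ?g z \<noteq> 0"
    using fZ z w[of z] inj by (auto simp: el[OF z] inj_on_def simp del: eval_pol_diff)
  ultimately show False by blast
qed

text \<open>Both spaces have dimension \<open>n + 1\<close>, so the relations in degree \<open>j\<close> are
  exactly the products of \<open>\<mu>\<close> with the binary forms of degree \<open>n\<close> on the line.\<close>

lemma relation_binary_multiple: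
  fixes X :: "(3 \<Rightarrow> 'k::field) set"
  assumes X: "finite X" and \<mu>: "relation X (n + j) \<mu>"
    and y: "\<And>p. p \<in> X \<Longrightarrow> \<mu> p \<noteq> 0 \<Longrightarrow> eval_pol (linear_form y) p = eval_pol (linear_form w) p * t p"
    and w: "\<And>p. p \<in> X \<Longrightarrow> \<mu> p \<noteq> 0 \<Longrightarrow> eval_pol (linear_form w) p \<noteq> 0"
    and inj: "inj_on t {p\<in>X. \<mu> p \<noteq> 0}" and card: "n < card {p\<in>X. \<mu> p \<noteq> 0}"
    and h: "card X \<le> hilbert_fun (vanishing X) j + (n + 1)"
    and \<nu>: "relation X j \<nu>"
  obtains b where "degree b \<le> n" "\<And>p. p \<in> X \<Longrightarrow> \<nu> p = \<mu> p * eval_pol (linear_form w) p ^ n * poly b (t p)"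
proof -
  let ?Z = "{p\<in>X. \<mu> p \<noteq> 0}" and ?w = "\<lambda>p. eval_pol (linear_form w) p"
  \<comment> \<open>The first \<open>n + 1\<close> entries are \<open>\<mu>\<close> times the binary
    forms \<open>w^(n-i) y^i\<close>, rewritten as \<open>w^n t^i\<close>; the last is
    \<open>\<nu>\<close>. Together they exceed the dimension by one.\<close>
  define \<theta> where "\<theta> i p = (if i \<le> n then \<mu> p * (?w p ^ n * t p ^ i) else \<nu> p)" for i :: nat and p
  have rel: "relation X j (\<theta> i)" if i: "i \<in> {..Suc n}" for i
  proof (cases "i \<le> n")
    case True
    let ?g = "linear_form w ^ (n - i) * linear_form y ^ i"
    have "?g \<in> forms ((n - i) * 1 + i * 1)"
      by (intro forms_mult forms_power linear_form_forms)
    then have "relation X j (\<lambda>p. \<mu> p * eval_pol ?g p)"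
      using True \<mu> by (intro relation_mult_form) auto
    moreover have "\<mu> p * eval_pol ?g p = \<theta> i p" if "p \<in> X" for p
      using y[OF that] True by (cases "\<mu> p = 0")
        (auto simp: \<theta>_def power_mult_distrib simp flip: power_add mult.assoc)
    ultimately show ?thesis by (simp add: relation_def)
  next
    case False
    then show ?thesis using \<nu> by (simp add: \<theta>_def[abs_def])
  qed
  obtain c where c: "\<exists>i\<in>{..Suc n}. c i \<noteq> 0" "\<And>p. p \<in> X \<Longrightarrow> (\<Sum>i\<le>Suc n. c i * \<theta> i p) = 0"
    using relations_dependent[OF X, of "{..Suc n}" j \<theta>] rel h by auto
  define b where "b = (\<Sum>i\<le>n. monom (c i) i)"
  have b: "poly b x = (\<Sum>i\<le>n. c i * x ^ i)" for x by (simp add: b_def poly_sum poly_monom)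
  have degb: "degree b \<le> n"
    unfolding b_def by (rule degree_sum_le) (auto intro: order_trans[OF degree_monom_le])
  have eq: "\<mu> p * ?w p ^ n * poly b (t p) + c (Suc n) * \<nu> p = 0" if "p \<in> X" for p
    using c(2)[OF that] by (simp add: \<theta>_def b sum_distrib_left mult_ac)
  \<comment> \<open>Otherwise \<open>b\<close> has more than \<open>n\<close> roots, the coordinates
    of the support of \<open>\<mu>\<close>, and all coefficients vanish.\<close>
  have "c (Suc n) \<noteq> 0"
  proof
    assume c0: "c (Suc n) = 0"
    have "t ` ?Z \<subseteq> {x. poly b x = 0}"
    proof
      fix x assume "x \<in> t ` ?Z"
      then obtain p where p: "p \<in> X" "\<mu> p \<noteq> 0" "x = t p" by blast
      then show "x \<in> {x. poly b x = 0}" using eq[of p] w[of p] c0 by simp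
    qed
    moreover have "card (t ` ?Z) = card ?Z" by (rule card_image[OF inj])
    ultimately have "b = 0"
      using card_mono[OF poly_roots_finite, of b "t ` ?Z"] card_poly_roots_bound[of b] degb card
      by fastforce
    have "c i = 0" if "i \<le> n" for i
    proof -
      have "coeff b i = (\<Sum>l\<le>n. if l = i then c l else 0)"
        unfolding b_def coeff_sum by (rule sum.cong) auto
      then show ?thesis using that \<open>b = 0\<close> by simp
    qed
    then show False using c(1) c0 by (auto simp: le_Suc_eq)
  qed
  then have "\<nu> p = \<mu> p * ?w p ^ n * poly (smult (- 1 / c (Suc n)) b) (t p)" if "p \<in> X" for p
    using eq[OF that] by (simp add: field_simps eq_neg_iff_add_eq_0)
  moreover have "degree (smult (- 1 / c (Suc n)) b) \<le> n"
    using degb degree_smult_le order_trans by blast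
  ultimately show ?thesis using that by blast
qed

text \<open>One \<open>a\<close> serves all \<open>j\<close> at once: only the finitely many
  \<open>j < \<tau>\<close> impose interpolation conditions, while for \<open>j \<ge> \<tau>\<close>
  it is enough that \<open>a\<close> is nonzero at every point.\<close>

lemma generic_weighted_form_nondegenerate:
  fixes X :: "(3 \<Rightarrow> 'k::field_char_0) set"
  assumes X: "projective_set X" and \<alpha>: "\<And>p. p \<in> X \<Longrightarrow> \<alpha> p \<noteq> 0"
    and d: "2 * \<tau> \<le> d" and k: "1 \<le> k" "k < \<tau>"
    and h: "\<And>n. k - 1 \<le> n \<Longrightarrow> n \<le> \<tau> \<Longrightarrow> hilbert_fun (vanishing X) n + (\<tau> - n) = card X"
  obtains a where "\<And>j f p. k - 1 \<le> j \<Longrightarrow> 2 * j \<le> d \<Longrightarrow> f \<in> forms j \<Longrightarrow>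
      (\<And>g. g \<in> forms j \<Longrightarrow>
        (\<Sum>p\<in>X. \<alpha> p * eval_pol (linear_form a) p ^ (d - 2 * j) * eval_pol f p * eval_pol g p) = 0) \<Longrightarrow>
      p \<in> X \<Longrightarrow> eval_pol f p = 0"
proof -
  have fX: "finite X" and nzX: "(\<lambda>_. 0) \<notin> X" using X by (auto simp: projective_set_def)
  have h\<tau>: "hilbert_fun (vanishing X) \<tau> = card X" using h[of \<tau>] k by simp
  \<comment> \<open>Since \<open>k < \<tau>\<close>, hypothesis \<open>h\<close> covers both
    \<open>m\<close> and \<open>Suc m\<close>, where the relations have dimensions two and
    one.\<close>
  define m where "m = \<tau> - 2"
  have m: "\<tau> = Suc (Suc m)" and km: "k - 1 \<le> m" using k by (simp_all add: m_def)
  obtain \<mu> where \<mu>: "relation X (Suc m) \<mu>" "\<exists>p\<in>X. \<mu> p \<noteq> 0"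
  proof -
    have "hilbert_fun (vanishing X) (Suc m) < card X" using h[of "Suc m"] km m by simp
    from nontrivial_relation_exists[OF fX this] show thesis using that by blast
  qed
  obtain c where c: "c \<noteq> (\<lambda>_. 0)" "\<And>p. p \<in> X \<Longrightarrow> \<mu> p \<noteq> 0 \<Longrightarrow> (\<Sum>i\<in>UNIV. c i * p i) = 0"
  proof -
    have "card X \<le> hilbert_fun (vanishing X) m + 2" using h[of m] km m by simp
    from relation_diff_supported_on_line[OF fX \<mu>(1) this] show thesis using that by blast
  qed
  define ev where "ev v p = eval_pol (linear_form v) p" for v p :: "3 \<Rightarrow> 'k"
  \<comment> \<open>\<open>Y\<close> may exceed the support \<open>Z\<close>: \<open>a\<close> must
    also be nonzero at points of the line where \<open>\<mu>\<close> vanishes.\<close>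
  define Y where "Y = {p\<in>X. ev c p = 0}"
  define Z where "Z = {p\<in>X. \<mu> p \<noteq> 0}"
  have ZY: "Z \<subseteq> Y" using c(2) by (auto simp: Y_def Z_def ev_def eval_pol_linear_form)
  have YX: "Y \<subseteq> X" by (auto simp: Y_def)
  have lineY: "(\<Sum>i\<in>UNIV. c i * p i) = 0" if "p \<in> Y" for p
    using that by (simp add: Y_def ev_def eval_pol_linear_form)
  obtain A B w y t where w: "\<And>p. p \<in> Y \<Longrightarrow> ev w p \<noteq> 0"
    and y: "\<And>p. p \<in> Y \<Longrightarrow> ev y p = ev w p * t p"
    and param: "\<And>p. p \<in> Y \<Longrightarrow> p = (\<lambda>i. ev w p * (A i + t p * B i))" and inj: "inj_on t Y"
  proof (rule line_parametrization[OF projective_set_subset[OF X YX] c(1) lineY, folded ev_def], goal_cases)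
    case (2 A B w y t)
    from 2(2-5) show ?case by (rule 2(1))
  qed assumption
  have fZ: "finite Z" and fY: "finite Y" using fX by (auto simp: Z_def Y_def)
  have injZ: "inj_on t Z" using inj ZY by (rule inj_on_subset)
  have memZ: "p \<in> Z" if "p \<in> X" "\<mu> p \<noteq> 0" for p using that by (simp add: Z_def)
  have w\<mu>: "eval_pol (linear_form w) p \<noteq> 0"
    and y\<mu>: "eval_pol (linear_form y) p = eval_pol (linear_form w) p * t p"
    if "p \<in> X" "\<mu> p \<noteq> 0" for p
    using w y memZ[OF that] ZY by (auto simp: ev_def)
  have cardZ: "\<tau> + 1 \<le> card Z"
    using relation_support_card[OF fX \<mu> w\<mu> y\<mu> injZ[unfolded Z_def]] m by (simp add: Z_def)
  have Z0: "Z \<noteq> {}" using cardZ by auto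
  \<comment> \<open>On the line \<open>a\<close> becomes \<open>w * (t - x)\<close> and
    \<open>f\<close> becomes \<open>w^j * q\<close>. Dividing the equation for the relation by
    \<open>\<alpha> * w^(d-j)\<close> leaves this factor in front of \<open>b\<close>.\<close>
  define \<gamma> where "\<gamma> j p = \<mu> p * ev w p ^ (\<tau> - 1 - j) / (\<alpha> p * ev w p ^ (d - j))" for j p
  define good where "good j c \<longleftrightarrow> (\<forall>q b. degree q \<le> j \<longrightarrow> (b = 0 \<or> degree b < \<tau> - j) \<longrightarrow>
    (\<forall>p\<in>Z. (t p - c) ^ (d - 2 * j) * poly q (t p) = \<gamma> j p * poly b (t p)) \<longrightarrow> q = 0)" for j c
  have "\<forall>j\<in>{..<\<tau>}. \<exists>E. finite E \<and> (\<forall>c. c \<notin> E \<longrightarrow> good j c)"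
  proof
    fix j assume "j \<in> {..<\<tau>}"
    \<comment> \<open>As \<open>card Z \<ge> \<tau> + 1\<close>, the two dimensions add up to at
      most \<open>d - 2 * j\<close>; if the second is truncated to 0,
      \<open>2 * \<tau> \<le> d\<close> and \<open>j < \<tau>\<close> suffice.\<close>
    then have "\<tau> - j + (d - 2 * j + j + 1 - card Z) \<le> d - 2 * j"
      using cardZ d by auto
    from generic_interpolation_trivial[OF fZ Z0 injZ this]
    show "\<exists>E. finite E \<and> (\<forall>c. c \<notin> E \<longrightarrow> good j c)" unfolding good_def .
  qed
  from bchoice[OF this] obtain E where E: "\<And>j. j < \<tau> \<Longrightarrow> finite (E j)"
    "\<And>j c. j < \<tau> \<Longrightarrow> c \<notin> E j \<Longrightarrow> good j c"
    by auto
  obtain x where x: "x \<notin> (\<Union>j<\<tau>. E j) \<union> t ` Y"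
    using finite_avoid[of "(\<Union>j<\<tau>. E j) \<union> t ` Y"] E(1) fY by auto
  \<comment> \<open>Adding a multiple of \<open>c\<close> leaves \<open>a\<close> unchanged on the
    line, so \<open>\<rho>\<close> can be chosen to make \<open>a\<close> nonzero at the points off
    it.\<close>
  obtain \<rho> where \<rho>: "\<rho> \<notin> (\<lambda>p. - (ev y p - x * ev w p) / ev c p) ` X"
    using finite_avoid[of "(\<lambda>p. - (ev y p - x * ev w p) / ev c p) ` X"] fX by auto
  define a where "a i = y i - x * w i + \<rho> * c i" for i
  have eva: "ev a p = ev y p - x * ev w p + \<rho> * ev c p" for p
    by (simp add: ev_def eval_pol_linear_form a_def algebra_simps sum.distrib sum_subtractf sum_distrib_left)
  have aY: "ev a p = ev w p * (t p - x)" if "p \<in> Y" for p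
    using that y[OF that] by (simp add: eva Y_def algebra_simps)
  have a0: "ev a p \<noteq> 0" if p: "p \<in> X" for p
  proof (cases "p \<in> Y")
    case True
    then show ?thesis using aY w x by auto
  next
    case False
    then have cp: "ev c p \<noteq> 0" using p by (simp add: Y_def)
    show ?thesis
    proof
      assume "ev a p = 0"
      then have "\<rho> * ev c p = - (ev y p - x * ev w p)"
        using eq_neg_iff_add_eq_0[of "\<rho> * ev c p"] by (simp only: eva add.commute)
      then have "\<rho> = - (ev y p - x * ev w p) / ev c p"
        by (rule iffD2[OF nonzero_eq_divide_eq[OF cp]])
      then show False using \<rho> p by blast
    qed
  qed
  have "eval_pol f p = 0" if j: "k - 1 \<le> j" "2 * j \<le> d" and f: "f \<in> forms j"
    and orth: "\<And>g. g \<in> forms j \<Longrightarrow>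
        (\<Sum>p\<in>X. \<alpha> p * ev a p ^ (d - 2 * j) * eval_pol f p * eval_pol g p) = 0" and p: "p \<in> X" for j f p
  proof -
    define \<nu> where "\<nu> p = \<alpha> p * ev a p ^ (d - 2 * j) * eval_pol f p" for p
    have rel: "relation X j \<nu>" using orth by (simp add: relation_def \<nu>_def)
    have \<nu>0: "eval_pol f p = 0" if "p \<in> X" "\<nu> p = 0" for p
      using that \<alpha>[of p] a0[of p] by (simp add: \<nu>_def)
    show ?thesis
    proof (cases "j < \<tau>")
      case False
      then show ?thesis using relation_trivial_above[OF fX h\<tau> nzX rel _ p] \<nu>0 p by simp
    next
      case True
      define n where "n = \<tau> - 1 - j"
      have n: "n + j = Suc m" "Suc n = \<tau> - j" using True m by (auto simp: n_def)
      have rel\<mu>: "relation X (n + j) \<mu>" using \<mu>(1) n by simp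
      have hn: "card X \<le> hilbert_fun (vanishing X) j + (n + 1)"
        using h[of j] j True n by simp
      obtain b where b: "degree b \<le> n" "\<And>p. p \<in> X \<Longrightarrow> \<nu> p = \<mu> p * ev w p ^ n * poly b (t p)"
        by (rule relation_binary_multiple[OF fX rel\<mu> y\<mu> w\<mu> injZ[unfolded Z_def] _ hn rel, folded ev_def])
          (use cardZ n m in \<open>auto simp: Z_def\<close>)
      obtain q where q: "degree q \<le> j" "\<And>s. poly q s = eval_pol f (\<lambda>i. A i + s * B i)"
        using restriction_to_line[OF f, of A B] by blast
      have fY: "eval_pol f p = ev w p ^ j * poly q (t p)" if "p \<in> Y" for p
        using eval_pol_homogeneous[OF f, of "ev w p" "\<lambda>i. A i + t p * B i"] param[OF that] q(2) by simp
      have "q = 0"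
      proof (rule E(2)[OF True, of x, unfolded good_def, rule_format])
        show "x \<notin> E j" using x True by auto
        show "degree q \<le> j" by (rule q)
        show "b = 0 \<or> degree b < \<tau> - j" using b(1) n by simp
        fix p assume p: "p \<in> Z"
        then have pY: "p \<in> Y" and pX: "p \<in> X" using ZY YX by auto
        have dj: "d - j = (d - 2 * j) + j" using j by simp
        have "\<alpha> p * (ev w p * (t p - x)) ^ (d - 2 * j) * (ev w p ^ j * poly q (t p))
            = \<mu> p * ev w p ^ n * poly b (t p)"
          using b(2)[OF pX] aY[OF pY] fY[OF pY] by (simp add: \<nu>_def)
        then have "\<alpha> p * ev w p ^ (d - j) * ((t p - x) ^ (d - 2 * j) * poly q (t p))
            = \<mu> p * ev w p ^ n * poly b (t p)"
          unfolding dj by (simp add: power_mult_distrib power_add mult_ac)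
        then show "(t p - x) ^ (d - 2 * j) * poly q (t p) = \<gamma> j p * poly b (t p)"
          using \<alpha>[OF pX] w[OF pY] by (simp add: \<gamma>_def n_def field_simps)
      qed
      show ?thesis
      proof (cases "p \<in> Y")
        case True
        then show ?thesis using fY \<open>q = 0\<close> by simp
      next
        case False
        then have "\<mu> p = 0" using ZY p memZ by blast
        then show ?thesis using b(2)[OF p] \<nu>0[OF p] by simp
      qed
    qed
  qed
  then show ?thesis using that[of a] unfolding ev_def by blast
qed

subsection \<open>The Hessian form\<close>

text \<open>\<open>vanishing X\<close> is an ideal containing the generators, and conversely a
  vanishing form is itself a generator.\<close>

lemma vanishing_ideal_forms:
  fixes X :: "(3 \<Rightarrow> 'k::field) set"
  assumes "f \<in> forms j"
  shows "f \<in> vanishing_ideal X \<longleftrightarrow> f \<in> vanishing X"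
proof -
  interpret m: Modules.module "(*) :: 'k pol \<Rightarrow> 'k pol \<Rightarrow> 'k pol"
    by unfold_locales (simp_all add: algebra_simps)
  let ?S = "{f :: 'k pol. (\<exists>j. f \<in> forms j) \<and> (\<forall>p\<in>X. eval_pol f p = 0)}"
  have "m.subspace (vanishing X)"
    by (rule m.subspaceI) (auto simp: vanishing_def)
  then have "m.span ?S \<subseteq> vanishing X"
    by (intro m.span_minimal) (auto simp: vanishing_def)
  moreover have "f \<in> m.span ?S" if "f \<in> vanishing X"
    using that assms by (intro m.span_base) (auto simp: vanishing_def)
  ultimately show ?thesis unfolding vanishing_ideal_def by blast
qed

lemma hilbert_fun_vanishing_tau:
  fixes X :: "(3 \<Rightarrow> 'k::field) set"
  assumes "projective_set X"
  shows "hilbert_fun (vanishing X) (tau X) = card X"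
proof -
  have eq: "hilbert_fun (vanishing_ideal X) = hilbert_fun (vanishing X)"
    by (rule ext, rule hilbert_fun_cong, rule vanishing_ideal_forms)
  show ?thesis
    unfolding tau_def eq
    by (rule LeastI[where P = "\<lambda>i. hilbert_fun (vanishing X) i = card X"])
      (rule hilbert_fun_eventually_card[OF assms])
qed

text \<open>If \<open>f\<close> annihilates the power sum, applying forms of the complementary
  degree \<open>d - j\<close> shows that the values \<open>\<beta> p * eval_pol f p\<close> form a
  relation. Since \<open>d - j\<close> is at least \<open>tau X\<close>, that relation is
  trivial.\<close>

lemma Ann_power_sum_forms:
  fixes X :: "(3 \<Rightarrow> 'k::field_char_0) set"
  assumes X: "projective_set X" and \<beta>: "\<And>p. p \<in> X \<Longrightarrow> \<beta> p \<noteq> 0"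
    and j: "j + tau X \<le> d" and f: "f \<in> forms j"
  shows "f \<in> Ann (\<Sum>p\<in>X. cst (\<beta> p) * linear_form p ^ d) \<longleftrightarrow> f \<in> vanishing X"
proof -
  have fX: "finite X" and nzX: "(\<lambda>_. 0) \<notin> X" using X by (auto simp: projective_set_def)
  define n where "n = d - j"
  have jd: "j \<le> d" and n: "tau X \<le> n" using j by (auto simp: n_def)
  define G where "G = (\<Sum>p\<in>X. cst (\<beta> p * eval_pol f p) * linear_form p ^ n)"
  have act: "act f (\<Sum>p\<in>X. cst (\<beta> p) * linear_form p ^ d) = cst (fact d / fact n) * G"
    unfolding G_def n_def by (rule act_power_sum[OF f jd])
  have "f \<in> vanishing X" if "cst (fact d / fact n) * G = 0"
  proof -
    have "G = cst (fact n / fact d) * (cst (fact d / fact n) * G)"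
      by (simp add: mult.assoc[symmetric] cst_mult)
    then have "G = 0" using that by simp
    have "relation X n (\<lambda>p. \<beta> p * eval_pol f p)"
      unfolding relation_def
    proof
      fix g :: "'k pol" assume g: "g \<in> forms n"
      have "act g G = cst (fact n) * (\<Sum>p\<in>X. cst (\<beta> p * eval_pol f p * eval_pol g p))"
        unfolding G_def by (subst act_power_sum[OF g order_refl]) simp
      \<comment> \<open>The result of the action is constant, so evaluation at the origin recovers
        its scalar.\<close>
      then have "eval_pol (cst (fact n) * (\<Sum>p\<in>X. cst (\<beta> p * eval_pol f p * eval_pol g p))) (\<lambda>_. 0) = 0"
        using \<open>G = 0\<close> by (metis act_0_right eval_pol_0)
      then show "(\<Sum>p\<in>X. \<beta> p * eval_pol f p * eval_pol g p) = 0" by simp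
    qed
    from relation_trivial_above[OF fX hilbert_fun_vanishing_tau[OF X] nzX this n]
    show ?thesis using \<beta> by (auto simp: vanishing_def)
  qed
  moreover have "G = 0" if "f \<in> vanishing X"
    using that by (simp add: G_def vanishing_def)
  ultimately show ?thesis unfolding Ann_def mem_Collect_eq act by (metis mult_zero_right)
qed

lemma eval_pol_linear_form_commute:
  "eval_pol (linear_form a) p = eval_pol (linear_form p) (a :: 3 \<Rightarrow> 'k::field)"
  by (simp add: eval_pol_linear_form mult.commute)

text \<open>The action of a product of degree \<open>2 * j\<close> leaves powers with exponent
  \<open>d - 2 * j\<close>; exchanging point and coefficients turns their values at \<open>a\<close>
  into weights at the points.\<close>

lemma hess_at_power_sum:
  fixes X :: "(3 \<Rightarrow> 'k::field_char_0) set"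
  assumes j: "2 * j \<le> d" and bs: "set bs \<subseteq> forms j" and u: "u < length bs" "v < length bs"
  shows "hess_at (linear_form a) (\<Sum>p\<in>X. cst (\<beta> p) * linear_form p ^ d) bs $$ (u, v)
    = fact d / fact (d - 2 * j) * (\<Sum>p\<in>X. \<beta> p * eval_pol (linear_form a) p ^ (d - 2 * j)
        * eval_pol (bs ! u) p * eval_pol (bs ! v) p)"
proof -
  have "bs ! u * bs ! v \<in> forms (j + j)" using bs u by (intro forms_mult) auto
  then have form: "bs ! u * bs ! v \<in> forms (2 * j)" by (simp add: mult_2)
  have "hess_at (linear_form a) (\<Sum>p\<in>X. cst (\<beta> p) * linear_form p ^ d) bs $$ (u, v)
      = eval_pol (act (bs ! u * bs ! v) (\<Sum>p\<in>X. cst (\<beta> p) * linear_form p ^ d)) a"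
    using u by (simp add: hess_at_def hess_def lookup_linear_form[unfolded One_nat_def])
  also have "\<dots> = fact d / fact (d - 2 * j) * (\<Sum>p\<in>X. \<beta> p * eval_pol (linear_form a) p ^ (d - 2 * j)
        * eval_pol (bs ! u) p * eval_pol (bs ! v) p)"
    by (subst act_power_sum[OF form j]) (simp add: eval_pol_linear_form_commute[of a] mult_ac)
  finally show ?thesis .
qed

theorem theorem4p7:
  fixes P :: "nat \<Rightarrow> 3 \<Rightarrow> 'k::field_char_0"
    and \<alpha> :: "nat \<Rightarrow> 'k"
    and s d k :: nat
    and X :: "(3 \<Rightarrow> 'k) set"
    and F :: "'k pol"
  assumes points: "distinct_points s P"
    and X: "X = P ` {..<s}"
    and d: "d \<ge> 2 * tau X"
    and alpha: "\<And>i. i < s \<Longrightarrow> \<alpha> i \<noteq> 0"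
    and F: "F = (\<Sum>i<s. cst (\<alpha> i) * linear_form (P i) ^ d)"
    and F_nz: "F \<noteq> 0"
    and k: "1 \<le> k" "k < tau X"
    and delta0: "delta_hilbert (Ann F) 0 = 1"
    and delta1: "delta_hilbert (Ann F) 1 = 2"
    and delta_k: "\<And>i. k \<le> i \<Longrightarrow> i \<le> tau X \<Longrightarrow> delta_hilbert (Ann F) i = 1"
  shows "\<exists>l\<in>forms 1. \<forall>j bs. k - 1 \<le> j \<longrightarrow> j \<le> d div 2 \<longrightarrow>
           quot_basis (Ann F) j bs \<longrightarrow> det (hess_at l F bs) \<noteq> 0"
proof -
  have same_refl: "same_point p p" for p :: "3 \<Rightarrow> 'k"
    unfolding same_point_def by (intro exI[of _ 1]) simp
  have inj: "inj_on P {..<s}"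
    using points same_refl unfolding distinct_points_def inj_on_def by (metis lessThan_iff)
  have proj: "projective_set X"
    using points unfolding X projective_set_def distinct_points_def by fastforce
  \<comment> \<open>Transfers the weights from indices to coordinate vectors, through the
    injectivity of \<open>P\<close>.\<close>
  define \<beta> where "\<beta> p = \<alpha> (inv_into {..<s} P p)" for p
  have \<beta>P: "\<beta> (P i) = \<alpha> i" if "i < s" for i
    using inj that by (simp add: \<beta>_def)
  have \<beta>: "\<beta> p \<noteq> 0" if "p \<in> X" for p
    using that \<beta>P alpha by (auto simp: X)
  have F': "F = (\<Sum>p\<in>X. cst (\<beta> p) * linear_form p ^ d)"
    unfolding F X by (simp add: sum.reindex[OF inj] \<beta>P)
  have Ann: "f \<in> Ann F \<longleftrightarrow> f \<in> vanishing X" if "f \<in> forms j" "j + tau X \<le> d" for f j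
    unfolding F' by (rule Ann_power_sum_forms[OF proj \<beta> that(2,1)])
  \<comment> \<open>For degrees up to \<open>tau X\<close>, the bound
    \<open>2 * tau X \<le> d\<close> puts \<open>Ann F\<close> in the range where it agrees with
    \<open>vanishing X\<close>.\<close>
  have suc: "int (hilbert_fun (vanishing X) (Suc i)) = int (hilbert_fun (vanishing X) i) + 1"
    if "k \<le> Suc i" "Suc i \<le> tau X" for i
  proof -
    have "hilbert_fun (Ann F) l = hilbert_fun (vanishing X) l" if "l \<le> tau X" for l
      using Ann d that by (intro hilbert_fun_cong) auto
    then show ?thesis using delta_k[OF that] that by (simp add: delta_hilbert_def)
  qed
  \<comment> \<open>Descending from degree \<open>tau X\<close>, where the value is
    \<open>card X\<close>, by unit steps; the last step uses the difference in degree
    \<open>k\<close> and reaches \<open>k - 1\<close>.\<close>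
  have h: "hilbert_fun (vanishing X) n + (tau X - n) = card X" if "k - 1 \<le> n" "n \<le> tau X" for n
    using that(2,1)
  proof (induction n rule: inc_induct)
    case base
    show ?case using hilbert_fun_vanishing_tau[OF proj] by simp
  next
    case (step i)
    then have i: "k \<le> Suc i" "Suc i \<le> tau X" by auto
    have "hilbert_fun (vanishing X) (Suc i) + (tau X - Suc i) = card X" using step by simp
    then show ?case using suc[OF i] i by linarith
  qed
  obtain a where a: "\<And>j f p. k - 1 \<le> j \<Longrightarrow> 2 * j \<le> d \<Longrightarrow> f \<in> forms j \<Longrightarrow>
      (\<And>g. g \<in> forms j \<Longrightarrow>
        (\<Sum>p\<in>X. \<beta> p * eval_pol (linear_form a) p ^ (d - 2 * j) * eval_pol f p * eval_pol g p) = 0) \<Longrightarrow>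
      p \<in> X \<Longrightarrow> eval_pol f p = 0"
    using generic_weighted_form_nondegenerate[where \<alpha> = \<beta>, OF proj \<beta> d k h] by blast
  have "det (hess_at (linear_form a) F bs) \<noteq> 0"
    if j: "k - 1 \<le> j" "j \<le> d div 2" and basis: "quot_basis (Ann F) j bs" for j bs
  proof
    let ?H = "hess_at (linear_form a) F bs" and ?n = "length bs"
    let ?B = "\<lambda>f g. \<Sum>p\<in>X. \<beta> p * eval_pol (linear_form a) p ^ (d - 2 * j) * eval_pol f p * eval_pol g p"
    assume "det ?H = 0"
    moreover have H: "?H \<in> carrier_mat ?n ?n" by (simp add: hess_at_def hess_def)
    ultimately obtain x where x: "x \<in> carrier_vec ?n" "x \<noteq> 0\<^sub>v ?n" "?H *\<^sub>v x = 0\<^sub>v ?n"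
      using det_0_iff_vec_prod_zero_field[OF H] by blast
    have j2: "2 * j \<le> d" "j + tau X \<le> d" using j d by auto
    have bs: "set bs \<subseteq> forms j" using basis by (simp add: quot_basis_def)
    \<comment> \<open>A kernel vector of a singular Hessian becomes a form in the radical of the
      weighted form.\<close>
    define f where "f = (\<Sum>v<?n. cst (x $ v) * bs ! v)"
    have f: "f \<in> forms j" unfolding f_def using bs by (intro forms_sum forms_cst_mult) auto
    have Bbs: "?B f (bs ! u) = 0" if u: "u < ?n" for u
    proof -
      have "0 = (?H *\<^sub>v x) $ u" using x(3) u by simp
      also have "\<dots> = (\<Sum>v<?n. ?H $$ (u, v) * x $ v)"
        using H x(1) u by (simp add: scalar_prod_def atLeast0LessThan)
      also have "\<dots> = (\<Sum>v<?n. fact d / fact (d - 2 * j) * (x $ v * ?B (bs ! v) (bs ! u)))"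
        using hess_at_power_sum[OF j2(1) bs u, where a = a and X = X and \<beta> = \<beta>]
        by (intro sum.cong) (simp_all add: F' mult_ac)
      also have "\<dots> = fact d / fact (d - 2 * j) * (\<Sum>v<?n. x $ v * ?B (bs ! v) (bs ! u))"
        by (rule sum_distrib_left[symmetric])
      also have "(\<Sum>v<?n. x $ v * ?B (bs ! v) (bs ! u)) = ?B f (bs ! u)"
        unfolding f_def sum_distrib_left by (subst sum.swap) (simp add: sum_distrib_left sum_distrib_right mult_ac)
      finally show ?thesis by simp
    qed
    \<comment> \<open>Any \<open>g\<close> is a combination of the basis modulo
      \<open>Ann F\<close>, whose elements of degree \<open>j\<close> vanish on \<open>X\<close> and
      so do not affect the weighted form.\<close>
    have "?B f g = 0" if g: "g \<in> forms j" for g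
    proof -
      obtain c where c: "g - (\<Sum>u<?n. cst (c u) * bs ! u) \<in> Ann F"
        using basis g unfolding quot_basis_def by blast
      moreover have "g - (\<Sum>u<?n. cst (c u) * bs ! u) \<in> forms j"
        using g bs by (intro forms_diff forms_sum forms_cst_mult) auto
      ultimately have "g - (\<Sum>u<?n. cst (c u) * bs ! u) \<in> vanishing X" using Ann j2 by blast
      then have "eval_pol g p = (\<Sum>u<?n. c u * eval_pol (bs ! u) p)" if "p \<in> X" for p
        using that by (simp add: vanishing_def)
      then have "?B f g = (\<Sum>p\<in>X. \<Sum>u<?n. c u * (\<beta> p * eval_pol (linear_form a) p ^ (d - 2 * j)
          * eval_pol f p * eval_pol (bs ! u) p))"
        by (intro sum.cong) (simp_all add: sum_distrib_left mult_ac)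
      also have "\<dots> = (\<Sum>u<?n. c u * ?B f (bs ! u))"
        by (subst sum.swap) (simp add: sum_distrib_left)
      finally show ?thesis using Bbs by simp
    qed
    then have "f \<in> vanishing X" using a[OF j(1) j2(1) f] by (simp add: vanishing_def)
    then have "f \<in> Ann F" using Ann f j2 by blast
    then have "\<forall>v<?n. x $ v = 0" using basis unfolding quot_basis_def f_def by blast
    then show False using x(1,2) by (auto simp: vec_eq_iff)
  qed
  then show ?thesis by (intro bexI[of _ "linear_form a"] linear_form_forms) blast
qed

end
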